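(* Let $t$ be a closed System T term of type $(\iota\Rightarrow\iota)\Rightarrow\iota$. Then for every $\alpha:\mathbb{N}\to\mathbb{N}$, the number $m:=[\![\mathsf{modulus}^T\,(\mathsf{dialogueTree}_\iota(t))]\!]\,\alpha$ is a modulus of continuity of $[\![t]\!]:(\mathbb{N}\to\mathbb{N})\to\mathbb{N}$ at $\alpha$, i.e. for all $\beta:\mathbb{N}\to\mathbb{N}$, if $\alpha(i)=\beta(i)$ for all $i<m$, then $[\![t]\!]\,\alpha=[\![t]\!]\,\beta$.
   Context: Metatheory: constructive Martin-Löf type theory without function extensionality; $\mathsf{Natrec}\,f\,x\,0=x$, $\mathsf{Natrec}\,f\,x\,(n+1)=f\,n\,(\mathsf{Natrec}\,f\,x\,n)$. System T: types generated by base type $\iota$ and $\sigma\Rightarrow\tau$; terms: variables, $\mathsf{zero}:\iota$, $\mathsf{succ}\,t$, $\mathsf{rec}_\sigma\,t\,p\,q:\sigma$ ($t:\iota\Rightarrow\sigma\Rightarrow\sigma$, $p:\sigma$, $q:\iota$), $\lambda$-abstraction and application. Set interpretation: $[\![\iota]\!]=\mathbb{N}$, $[\![\sigma\Rightarrow\tau]\!]=[\![\sigma]\!]\to[\![\tau]\!]$, $[\![\mathsf{zero}]\!]=0$, $[\![\mathsf{succ}\,t]\!]\gamma=[\![t]\!]\gamma+1$, $[\![\mathsf{rec}_\sigma t_1t_2t_3]\!]\gamma=\mathsf{Natrec}([\![t_1]\!]\gamma)([\![t_2]\!]\gamma)([\![t_3]\!]\gamma)$, standard clauses for variables, $\lambda$,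 application; $[\![t]\!]$ for closed $t$. Internal dialogue trees: for System T types $A,\sigma$, $\mathsf{ChD}_A(\sigma):=(\sigma\Rightarrow A)\Rightarrow((\iota\Rightarrow A)\Rightarrow\iota\Rightarrow A)\Rightarrow A$; $\eta_A:=\lambda z\,e\,b.\,e\,z$; $\beta_A:=\lambda\varphi\,x\,e\,b.\,b\,(\lambda y.\varphi\,y\,e\,b)\,x$; $K_A:=\lambda f\,d\,e'\,b'.\,d\,(\lambda x.f\,x\,e'\,b')\,b'$; $\mathsf{map}_A:=\lambda f.K_A(\lambda x.\eta_A(f\,x))$. Type translation $\lceil\iota\rceil_A=\mathsf{ChD}_A(\iota)$, $\lceil\sigma\Rightarrow\tau\rceil_A=\lceil\sigma\rceil_A\Rightarrow\lceil\tau\rceil_A$. $\mathsf{ext}^T_{\iota,A}:=K_A$, $\mathsf{ext}^T_{\sigma_1\Rightarrow\sigma_2,A}:=\lambda f\,d\,s.\mathsf{ext}^T_{\sigma_2,A}(\lambda x.f\,x\,s)\,d$. Term translation: $\lceil x\rceil_A=x$, $\lceil\mathsf{zero}\rceil_A=\eta_A\,\mathsf{zero}$, $\lceil\mathsf{succ}\,t\rceil_A=\mathsf{map}_A(\lambda n.\mathsf{succ}\,n)\lceil t\rceil_A$, $\lceil\mathsf{rec}_\sigma t_1t_2t_3\rceil_A=\mathsf{ext}^T_{\sigma,A}(\lambda n.\mathsf{rec}_{\lceil\sigma\rceil_A}(\lambda x.\lceil t_1\rceil_A(\eta_A x))\lceil t_2\rceil_A\,n)\lceil t_3\rceil_A$,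 $\lambda$ and application translated homomorphically. $\mathsf{generic}_A:=K_A(\lambda i.\beta_A\,\eta_A\,i)$; $\mathsf{dialogueTree}_A(t):=\lceil t\rceil_A\,\mathsf{generic}_A$ for closed $t:(\iota\Rightarrow\iota)\Rightarrow\iota$. Fix a closed System T term $\mathsf{max}^T:\iota\Rightarrow\iota\Rightarrow\iota$ with $[\![\mathsf{max}^T]\!]\,a\,b=\max(a,b)$. $\mathsf{maxQ}^T:=\lambda d\,\alpha.\,d\,(\lambda w.\mathsf{zero})\,(\lambda g\,x.\,\mathsf{max}^T\,x\,(g\,(\alpha\,x)))$ of type $\mathsf{ChD}_\iota(\iota)\Rightarrow(\iota\Rightarrow\iota)\Rightarrow\iota$, and $\mathsf{modulus}^T:=\lambda d\,\alpha.\,\mathsf{succ}(\mathsf{maxQ}^T\,d\,\alpha)$. *)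

theory Defs
  imports Main "HOL-Library.FuncSet"
begin

datatype ty = Iota (\<open>\<iota>\<close>) | Fun ty ty (infixr \<open>\<rightarrow>\<^sub>T\<close> 65)

text \<open>Variables are de Bruijn indices; abstraction is annotated with the type of the bound
  variable and the recursor with its result type.\<close>

datatype tm =
    Var nat
  | Zero
  | Succ tm
  | Rec ty tm tm tm
  | Lam ty tm
  | App tm tm (infixl \<open>\<cdot>\<close> 90)

inductive has_type :: "ty list \<Rightarrow> tm \<Rightarrow> ty \<Rightarrow> bool" (\<open>(_ \<turnstile> _ : _)\<close> [50, 50, 50] 50) where
  Var: "i < length \<Gamma> \<Longrightarrow> \<Gamma> \<turnstile> Var i : \<Gamma> ! i"
| Zero: "\<Gamma> \<turnstile> Zero : \<iota>"
| Succ: "\<Gamma> \<turnstile> t : \<iota> \<Longrightarrow> \<Gamma> \<turnstile> Succ t : \<iota>"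
| Rec: "\<Gamma> \<turnstile> t : \<iota> \<rightarrow>\<^sub>T \<sigma> \<rightarrow>\<^sub>T \<sigma> \<Longrightarrow> \<Gamma> \<turnstile> p : \<sigma> \<Longrightarrow> \<Gamma> \<turnstile> q : \<iota> \<Longrightarrow> \<Gamma> \<turnstile> Rec \<sigma> t p q : \<sigma>"
| Lam: "\<sigma> # \<Gamma> \<turnstile> t : \<tau> \<Longrightarrow> \<Gamma> \<turnstile> Lam \<sigma> t : \<sigma> \<rightarrow>\<^sub>T \<tau>"
| App: "\<Gamma> \<turnstile> t : \<sigma> \<rightarrow>\<^sub>T \<tau> \<Longrightarrow> \<Gamma> \<turnstile> u : \<sigma> \<Longrightarrow> \<Gamma> \<turnstile> t \<cdot> u : \<tau>"

text \<open>\<open>lift k t\<close> weakens \<open>t\<close> by one variable inserted at index \<open>k\<close>.\<close>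

primrec lift :: "nat \<Rightarrow> tm \<Rightarrow> tm" where
  "lift k (Var i) = Var (if i < k then i else Suc i)"
| "lift k Zero = Zero"
| "lift k (Succ t) = Succ (lift k t)"
| "lift k (Rec \<sigma> t p q) = Rec \<sigma> (lift k t) (lift k p) (lift k q)"
| "lift k (Lam \<sigma> t) = Lam \<sigma> (lift (Suc k) t)"
| "lift k (t \<cdot> u) = lift k t \<cdot> lift k u"

primrec term_types :: "ty list \<Rightarrow> tm \<Rightarrow> ty set" where
  "term_types \<Gamma> (Var i) = {\<tau>. \<Gamma> \<turnstile> Var i : \<tau>}"
| "term_types \<Gamma> Zero = {\<tau>. \<Gamma> \<turnstile> Zero : \<tau>}"
| "term_types \<Gamma> (Succ t) = {\<tau>. \<Gamma> \<turnstile> Succ t : \<tau>} \<union> term_types \<Gamma> t"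
| "term_types \<Gamma> (Rec \<sigma> t p q) =
    {\<tau>. \<Gamma> \<turnstile> Rec \<sigma> t p q : \<tau>} \<union> term_types \<Gamma> t \<union> term_types \<Gamma> p \<union> term_types \<Gamma> q"
| "term_types \<Gamma> (Lam \<sigma> t) = {\<tau>. \<Gamma> \<turnstile> Lam \<sigma> t : \<tau>} \<union> term_types (\<sigma> # \<Gamma>) t"
| "term_types \<Gamma> (t \<cdot> u) = {\<tau>. \<Gamma> \<turnstile> t \<cdot> u : \<tau>} \<union> term_types \<Gamma> t \<union> term_types \<Gamma> u"

lemma type_unique: "\<Gamma> \<turnstile> t : \<tau> \<Longrightarrow> \<Gamma> \<turnstile> t : \<tau>' \<Longrightarrow> \<tau> = \<tau>'"
proof (induction arbitrary: \<tau>' rule: has_type.induct)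
  case (Var i \<Gamma>)
  from Var.prems show ?case by cases simp
next
  case (Zero \<Gamma>)
  then show ?case by cases simp
next
  case (Succ \<Gamma> t)
  from Succ.prems show ?case by cases simp
next
  case (Rec \<Gamma> t \<sigma> p q)
  from Rec.prems show ?case by cases simp
next
  case (Lam \<sigma> \<Gamma> t \<tau>)
  from Lam.prems show ?case by cases (simp add: Lam.IH)
next
  case (App \<Gamma> t \<sigma> \<tau> u)
  from App.prems show ?case by cases (blast dest: App.IH(1))
qed

lemma finite_term_types: "finite (term_types \<Gamma> t)"
proof -
  have "finite {\<tau>. \<Gamma> \<turnstile> t : \<tau>}" for \<Gamma> t
  proof (cases "\<exists>\<tau>. \<Gamma> \<turnstile> t : \<tau>")
    case True
    then obtain \<tau> where "\<Gamma> \<turnstile> t : \<tau>" by blast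
    then have "{\<tau>. \<Gamma> \<turnstile> t : \<tau>} \<subseteq> {\<tau>}" using type_unique by blast
    then show ?thesis using finite_subset by blast
  qed simp
  then show ?thesis by (induction t arbitrary: \<Gamma>) (simp_all only: term_types.simps finite_Un)
qed


section \<open>The set interpretation\<close>

text \<open>
  No definable HOL type contains, at all finite types at once, the full function spaces over the
  naturals.  The interpretation is therefore taken in an arbitrary universe that encodes numbers
  and functions, and \<open>supports U \<sigma>\<close> states that the encoding is faithful at \<open>\<sigma>\<close> and at every type occurring in it, so
  that \<open>elems U (\<sigma> \<rightarrow>\<^sub>T \<tau>)\<close> is in bijection with the set of all functions
  \<open>elems U \<sigma> \<rightarrow>\<^sub>E elems U \<tau>\<close>. A term only involves finitely many types, so it can be interpreted in
  a suitable HOL type; see \<open>base_universe\<close> and \<open>next_universe\<close> below.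

  \<open>fun_code U A f\<close> is the code of the function \<open>f\<close> with domain \<open>A\<close> (where \<open>f\<close> is extensional
  on \<open>A\<close>), and \<open>ap\<close> is application of codes.
\<close>

record 'u universe =
  num :: "nat \<Rightarrow> 'u"
  fun_code :: "'u set \<Rightarrow> ('u \<Rightarrow> 'u) \<Rightarrow> 'u"
  ap :: "'u \<Rightarrow> 'u \<Rightarrow> 'u"

primrec elems :: "'u universe \<Rightarrow> ty \<Rightarrow> 'u set" where
  "elems U \<iota> = range (num U)"
| "elems U (\<sigma> \<rightarrow>\<^sub>T \<tau>) = fun_code U (elems U \<sigma>) ` (elems U \<sigma> \<rightarrow>\<^sub>E elems U \<tau>)"

primrec supports :: "'u universe \<Rightarrow> ty \<Rightarrow> bool" where
  "supports U \<iota> \<longleftrightarrow> inj (num U)"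
| "supports U (\<sigma> \<rightarrow>\<^sub>T \<tau>) \<longleftrightarrow> supports U \<sigma> \<and> supports U \<tau> \<and>
    (\<forall>f \<in> elems U \<sigma> \<rightarrow>\<^sub>E elems U \<tau>. \<forall>x \<in> elems U \<sigma>. ap U (fun_code U (elems U \<sigma>) f) x = f x)"

abbreviation supports_term :: "'u universe \<Rightarrow> tm \<Rightarrow> bool" where
  "supports_term U t \<equiv> \<forall>\<sigma> \<in> term_types [] t. supports U \<sigma>"

definition to_nat :: "'u universe \<Rightarrow> 'u \<Rightarrow> nat" where
  "to_nat U = inv (num U)"

primrec sem :: "'u universe \<Rightarrow> tm \<Rightarrow> 'u list \<Rightarrow> 'u" where
  "sem U (Var i) \<gamma> = \<gamma> ! i"
| "sem U Zero \<gamma> = num U 0"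
| "sem U (Succ t) \<gamma> = num U (to_nat U (sem U t \<gamma>) + 1)"
| "sem U (Rec \<sigma> t p q) \<gamma> =
    rec_nat (sem U p \<gamma>) (\<lambda>n r. ap U (ap U (sem U t \<gamma>) (num U n)) r) (to_nat U (sem U q \<gamma>))"
| "sem U (Lam \<sigma> t) \<gamma> = fun_code U (elems U \<sigma>) (\<lambda>x \<in> elems U \<sigma>. sem U t (x # \<gamma>))"
| "sem U (t \<cdot> u) \<gamma> = ap U (sem U t \<gamma>) (sem U u \<gamma>)"

definition seq_code :: "'u universe \<Rightarrow> (nat \<Rightarrow> nat) \<Rightarrow> 'u" where
  "seq_code U \<alpha> = fun_code U (elems U \<iota>) (\<lambda>x \<in> elems U \<iota>. num U (\<alpha> (to_nat U x)))"

text \<open>The interpretation of a closed term of type \<open>(\<iota> \<rightarrow>\<^sub>T \<iota>) \<rightarrow>\<^sub>T \<iota>\<close> as an actual functional.\<close>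

definition functional :: "'u universe \<Rightarrow> tm \<Rightarrow> (nat \<Rightarrow> nat) \<Rightarrow> nat" where
  "functional U t \<alpha> = to_nat U (ap U (sem U t []) (seq_code U \<alpha>))"

lemma base_universe: "\<exists>U :: nat universe. supports U \<iota>"
  by (rule exI[of _ "\<lparr>num = id, fun_code = undefined, ap = undefined\<rparr>"]) simp

text \<open>Every universe extends to one that in addition supports all types \<open>\<sigma> \<rightarrow>\<^sub>T \<tau>\<close> with \<open>\<sigma>\<close>, \<open>\<tau>\<close>
  already supported.  Iterating this, any finite set of types is supported by some universe.\<close>

lemma next_universe:
  fixes U :: "'u universe"
  shows "\<exists>U' :: ('u + ('u \<Rightarrow> 'u)) universe.
    (\<forall>\<sigma>. supports U \<sigma> \<longrightarrow> supports U' \<sigma>) \<and>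
    (\<forall>\<sigma> \<tau>. supports U \<sigma> \<longrightarrow> supports U \<tau> \<longrightarrow> supports U' (\<sigma> \<rightarrow>\<^sub>T \<tau>))"
proof -
  define res where "res A f = (\<lambda>x \<in> Inl -` A. projl (f (Inl x)))"
    for A :: "('u + ('u \<Rightarrow> 'u)) set" and f :: "('u + ('u \<Rightarrow> 'u)) \<Rightarrow> 'u + ('u \<Rightarrow> 'u)"
  define old where "old A f \<longleftrightarrow> (\<exists>\<sigma> \<tau>. supports U (\<sigma> \<rightarrow>\<^sub>T \<tau>) \<and> A = Inl ` elems U \<sigma> \<and>
      f \<in> A \<rightarrow>\<^sub>E Inl ` elems U \<tau>)"
    for A :: "('u + ('u \<Rightarrow> 'u)) set" and f :: "('u + ('u \<Rightarrow> 'u)) \<Rightarrow> 'u + ('u \<Rightarrow> 'u)"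
  define V where "V = \<lparr>num = (\<lambda>n. Inl (num U n)),
    fun_code = (\<lambda>A f. if old A f then Inl (fun_code U (Inl -` A) (res A f)) else Inr (res A f)),
    ap = (\<lambda>v x. case v of Inl c \<Rightarrow> Inl (ap U c (projl x)) | Inr g \<Rightarrow> Inl (g (projl x)))\<rparr>"
  have vim: "Inl -` (Inl ` A) = A" for A :: "'u set"
    by auto
  have res: "res (Inl ` A) f \<in> A \<rightarrow>\<^sub>E B" "x \<in> A \<Longrightarrow> Inl (res (Inl ` A) f x) = f (Inl x)"
    if "f \<in> Inl ` A \<rightarrow>\<^sub>E Inl ` B" for A B f x
  proof -
    have *: "\<exists>b\<in>B. f (Inl x) = Inl b" if "x \<in> A" for x
      using \<open>f \<in> _\<close> that by (auto simp: PiE_def Pi_def)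
    show "res (Inl ` A) f \<in> A \<rightarrow>\<^sub>E B"
      using * by (fastforce simp: res_def vim)
    show "x \<in> A \<Longrightarrow> Inl (res (Inl ` A) f x) = f (Inl x)"
      using *[of x] by (auto simp: res_def vim)
  qed
  have beta: "ap V (fun_code V (Inl ` elems U \<sigma>) f) x = f x"
    if f: "f \<in> Inl ` elems U \<sigma> \<rightarrow>\<^sub>E Inl ` elems U \<tau>" and x: "x \<in> Inl ` elems U \<sigma>" for \<sigma> \<tau> f x
  proof -
    obtain y where y: "y \<in> elems U \<sigma>" "x = Inl y"
      using x by blast
    show ?thesis
    proof (cases "old (Inl ` elems U \<sigma>) f")
      case True
      then obtain \<sigma>' \<tau>' where s: "supports U (\<sigma>' \<rightarrow>\<^sub>T \<tau>')" and e: "elems U \<sigma> = elems U \<sigma>'"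
        and f': "f \<in> Inl ` elems U \<sigma> \<rightarrow>\<^sub>E Inl ` elems U \<tau>'"
        unfolding old_def inj_image_eq_iff[OF inj_Inl] by (elim exE conjE) (rule that)
      have "ap U (fun_code U (elems U \<sigma>) (res (Inl ` elems U \<sigma>) f)) y = res (Inl ` elems U \<sigma>) f y"
        using s y(1) res(1)[OF f'] unfolding e supports.simps by blast
      then show ?thesis
        using True y res(2)[OF f] by (simp add: V_def vim)
    next
      case False
      then show ?thesis
        using y res(2)[OF f] by (simp add: V_def)
    qed
  qed
  have el: "elems V \<sigma> = Inl ` elems U \<sigma>" if "supports U \<sigma>" for \<sigma>
    using that
  proof (induction \<sigma>)
    case Iota
    show ?case by (auto simp: V_def)
  next
    case (Fun \<sigma> \<tau>)
    let ?A = "elems U \<sigma>" and ?B = "elems U \<tau>"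
    have IH: "elems V \<sigma> = Inl ` ?A" "elems V \<tau> = Inl ` ?B"
      using Fun by auto
    have code: "fun_code V (Inl ` ?A) f = Inl (fun_code U ?A (res (Inl ` ?A) f))"
      if "f \<in> Inl ` ?A \<rightarrow>\<^sub>E Inl ` ?B" for f
    proof -
      have "old (Inl ` ?A) f"
        using that Fun.prems unfolding old_def by (intro exI[of _ \<sigma>] exI[of _ \<tau>]) simp
      then show ?thesis
        by (simp add: V_def vim)
    qed
    have onto: "\<exists>f \<in> Inl ` ?A \<rightarrow>\<^sub>E Inl ` ?B. res (Inl ` ?A) f = g" if g: "g \<in> ?A \<rightarrow>\<^sub>E ?B" for g
    proof
      let ?f = "\<lambda>z \<in> Inl ` ?A. (Inl (g (projl z)) :: 'u + ('u \<Rightarrow> 'u))"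
      show "?f \<in> Inl ` ?A \<rightarrow>\<^sub>E Inl ` ?B"
        using g by auto
      show "res (Inl ` ?A) ?f = g"
        using g by (auto simp: res_def vim fun_eq_iff PiE_def extensional_def restrict_def)
    qed
    have im: "res (Inl ` ?A) ` (Inl ` ?A \<rightarrow>\<^sub>E Inl ` ?B) = ?A \<rightarrow>\<^sub>E ?B"
    proof
      show "res (Inl ` ?A) ` (Inl ` ?A \<rightarrow>\<^sub>E Inl ` ?B) \<subseteq> ?A \<rightarrow>\<^sub>E ?B"
        using res(1) by (rule image_subsetI)
      show "?A \<rightarrow>\<^sub>E ?B \<subseteq> res (Inl ` ?A) ` (Inl ` ?A \<rightarrow>\<^sub>E Inl ` ?B)"
        by (rule subsetI, drule onto, erule bexE) (rule image_eqI, erule sym)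
    qed
    have "elems V (\<sigma> \<rightarrow>\<^sub>T \<tau>) =
        (\<lambda>f. Inl (fun_code U ?A (res (Inl ` ?A) f))) ` (Inl ` ?A \<rightarrow>\<^sub>E Inl ` ?B)"
      unfolding elems.simps IH by (rule image_cong[OF refl code])
    also have "\<dots> = Inl ` elems U (\<sigma> \<rightarrow>\<^sub>T \<tau>)"
      unfolding elems.simps im[symmetric] image_image ..
    finally show ?case .
  qed
  have step: "supports V (\<sigma> \<rightarrow>\<^sub>T \<tau>)"
    if "supports U \<sigma>" "supports U \<tau>" "supports V \<sigma>" "supports V \<tau>" for \<sigma> \<tau>
    using that beta by (simp add: el)
  have keep: "supports V \<sigma>" if "supports U \<sigma>" for \<sigma>
    using that
  proof (induction \<sigma>)
    case Iota
    then show ?case by (auto simp: V_def inj_def)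
  next
    case (Fun \<sigma> \<tau>)
    then show ?case by (intro step) simp_all
  qed
  show ?thesis
    using keep step by blast
qed


section \<open>Internal dialogue trees\<close>

abbreviation BrT :: "ty \<Rightarrow> ty" where
  "BrT A \<equiv> (\<iota> \<rightarrow>\<^sub>T A) \<rightarrow>\<^sub>T \<iota> \<rightarrow>\<^sub>T A"

definition ChD :: "ty \<Rightarrow> ty \<Rightarrow> ty" where
  "ChD A \<sigma> = (\<sigma> \<rightarrow>\<^sub>T A) \<rightarrow>\<^sub>T BrT A \<rightarrow>\<^sub>T A"

text \<open>\<open>\<lambda>z e b. e z\<close>\<close>
definition etaT :: "ty \<Rightarrow> ty \<Rightarrow> tm" where
  "etaT A \<sigma> = Lam \<sigma> (Lam (\<sigma> \<rightarrow>\<^sub>T A) (Lam (BrT A) (Var 1 \<cdot> Var 2)))"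

text \<open>\<open>\<lambda>\<phi> x e b. b (\<lambda>y. \<phi> y e b) x\<close>\<close>
definition betaT :: "ty \<Rightarrow> ty \<Rightarrow> tm" where
  "betaT A \<sigma> = Lam (\<iota> \<rightarrow>\<^sub>T ChD A \<sigma>) (Lam \<iota> (Lam (\<sigma> \<rightarrow>\<^sub>T A) (Lam (BrT A)
    (Var 0 \<cdot> Lam \<iota> (Var 4 \<cdot> Var 0 \<cdot> Var 2 \<cdot> Var 1) \<cdot> Var 2))))"

text \<open>\<open>\<lambda>f d e' b'. d (\<lambda>x. f x e' b') b'\<close>\<close>
definition kleisliT :: "ty \<Rightarrow> ty \<Rightarrow> ty \<Rightarrow> tm" where
  "kleisliT A \<sigma> \<tau> = Lam (\<sigma> \<rightarrow>\<^sub>T ChD A \<tau>) (Lam (ChD A \<sigma>) (Lam (\<tau> \<rightarrow>\<^sub>T A) (Lam (BrT A)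
    (Var 2 \<cdot> Lam \<sigma> (Var 4 \<cdot> Var 0 \<cdot> Var 2 \<cdot> Var 1) \<cdot> Var 0))))"

text \<open>\<open>\<lambda>f. K (\<lambda>x. \<eta> (f x))\<close>\<close>
definition mapT :: "ty \<Rightarrow> ty \<Rightarrow> ty \<Rightarrow> tm" where
  "mapT A \<sigma> \<tau> = Lam (\<sigma> \<rightarrow>\<^sub>T \<tau>) (kleisliT A \<sigma> \<tau> \<cdot> Lam \<sigma> (etaT A \<tau> \<cdot> (Var 1 \<cdot> Var 0)))"

primrec trans_ty :: "ty \<Rightarrow> ty \<Rightarrow> ty" where
  "trans_ty A \<iota> = ChD A \<iota>"
| "trans_ty A (\<sigma> \<rightarrow>\<^sub>T \<tau>) = trans_ty A \<sigma> \<rightarrow>\<^sub>T trans_ty A \<tau>"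

text \<open>At \<open>\<sigma> \<rightarrow>\<^sub>T \<tau>\<close>: \<open>\<lambda>f d s. ext\<^bsub>\<tau>\<^esub> (\<lambda>x. f x s) d\<close>\<close>
primrec extT :: "ty \<Rightarrow> ty \<Rightarrow> tm" where
  "extT A \<iota> = kleisliT A \<iota> \<iota>"
| "extT A (\<sigma> \<rightarrow>\<^sub>T \<tau>) =
    Lam (\<iota> \<rightarrow>\<^sub>T trans_ty A (\<sigma> \<rightarrow>\<^sub>T \<tau>)) (Lam (trans_ty A \<iota>) (Lam (trans_ty A \<sigma>)
      (extT A \<tau> \<cdot> Lam \<iota> (Var 3 \<cdot> Var 0 \<cdot> Var 1) \<cdot> Var 1)))"

primrec trans_tm :: "ty \<Rightarrow> tm \<Rightarrow> tm" where
  "trans_tm A (Var i) = Var i"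
| "trans_tm A Zero = etaT A \<iota> \<cdot> Zero"
| "trans_tm A (Succ t) = mapT A \<iota> \<iota> \<cdot> Lam \<iota> (Succ (Var 0)) \<cdot> trans_tm A t"
| "trans_tm A (Rec \<sigma> t p q) =
    extT A \<sigma> \<cdot>
      Lam \<iota> (Rec (trans_ty A \<sigma>)
        (Lam \<iota> (lift 0 (lift 0 (trans_tm A t)) \<cdot> (etaT A \<iota> \<cdot> Var 0)))
        (lift 0 (trans_tm A p))
        (Var 0)) \<cdot>
      trans_tm A q"
| "trans_tm A (Lam \<sigma> t) = Lam (trans_ty A \<sigma>) (trans_tm A t)"
| "trans_tm A (t \<cdot> u) = trans_tm A t \<cdot> trans_tm A u"

text \<open>\<open>K (\<lambda>i. \<beta> \<eta> i)\<close>\<close>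
definition genericT :: "ty \<Rightarrow> tm" where
  "genericT A = kleisliT A \<iota> \<iota> \<cdot> Lam \<iota> (betaT A \<iota> \<cdot> etaT A \<iota> \<cdot> Var 0)"

definition dialogue_tree :: "ty \<Rightarrow> tm \<Rightarrow> tm" where
  "dialogue_tree A t = trans_tm A t \<cdot> genericT A"

lemma lift_typed:
  assumes "\<Gamma> @ \<Delta> \<turnstile> t : \<tau>"
  shows "\<Gamma> @ \<rho> # \<Delta> \<turnstile> lift (length \<Gamma>) t : \<tau>"
  using assms
proof (induction "\<Gamma> @ \<Delta>" t \<tau> arbitrary: \<Gamma> rule: has_type.induct)
  case (Var i)
  have "(\<Gamma> @ \<rho> # \<Delta>) ! (if i < length \<Gamma> then i else Suc i) = (\<Gamma> @ \<Delta>) ! i"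
    by (auto simp: nth_append Suc_diff_le)
  then show ?case
    using Var has_type.Var[of "if i < length \<Gamma> then i else Suc i" "\<Gamma> @ \<rho> # \<Delta>"] by auto
next
  case (Lam \<sigma> t \<tau>)
  then show ?case
    using Lam(2)[of "\<sigma> # \<Gamma>"] by (auto intro: has_type.intros)
qed (auto intro: has_type.intros)

lemma Var_typed: "i < length \<Gamma> \<Longrightarrow> \<Gamma> ! i = \<tau> \<Longrightarrow> \<Gamma> \<turnstile> Var i : \<tau>"
  using has_type.Var by blast

lemma etaT_typed: "\<Gamma> \<turnstile> etaT A \<sigma> : \<sigma> \<rightarrow>\<^sub>T ChD A \<sigma>"
  unfolding etaT_def ChD_def by (rule has_type.intros Var_typed | simp)+

lemma betaT_typed: "\<Gamma> \<turnstile> betaT A \<sigma> : (\<iota> \<rightarrow>\<^sub>T ChD A \<sigma>) \<rightarrow>\<^sub>T \<iota> \<rightarrow>\<^sub>T ChD A \<sigma>"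
  unfolding betaT_def ChD_def by (rule has_type.intros Var_typed | simp)+

lemma kleisliT_typed: "\<Gamma> \<turnstile> kleisliT A \<sigma> \<tau> : (\<sigma> \<rightarrow>\<^sub>T ChD A \<tau>) \<rightarrow>\<^sub>T ChD A \<sigma> \<rightarrow>\<^sub>T ChD A \<tau>"
  unfolding kleisliT_def ChD_def by (rule has_type.intros Var_typed | simp)+

lemma mapT_typed: "\<Gamma> \<turnstile> mapT A \<sigma> \<tau> : (\<sigma> \<rightarrow>\<^sub>T \<tau>) \<rightarrow>\<^sub>T ChD A \<sigma> \<rightarrow>\<^sub>T ChD A \<tau>"
  unfolding mapT_def by (rule kleisliT_typed etaT_typed has_type.intros Var_typed | simp)+

lemma extT_typed:
  "\<Gamma> \<turnstile> extT A \<sigma> : (\<iota> \<rightarrow>\<^sub>T trans_ty A \<sigma>) \<rightarrow>\<^sub>T trans_ty A \<iota> \<rightarrow>\<^sub>T trans_ty A \<sigma>"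
proof (induction \<sigma> arbitrary: \<Gamma>)
  case Iota
  show ?case by (simp add: kleisliT_typed)
next
  case (Fun \<sigma> \<tau>)
  show ?case
    unfolding extT.simps trans_ty.simps(2)
    by (rule Fun(2) has_type.intros Var_typed | simp)+
qed

lemma trans_tm_typed:
  "\<Gamma> \<turnstile> t : \<tau> \<Longrightarrow> map (trans_ty A) \<Gamma> \<turnstile> trans_tm A t : trans_ty A \<tau>"
proof (induction rule: has_type.induct)
  case (Var i \<Gamma>)
  then show ?case by (auto intro: Var_typed)
next
  case (Zero \<Gamma>)
  show ?case by (auto intro: has_type.intros etaT_typed)
next
  case (Succ \<Gamma> t)
  have "map (trans_ty A) \<Gamma> \<turnstile> Lam \<iota> (Succ (Var 0)) : \<iota> \<rightarrow>\<^sub>T \<iota>"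
    by (rule has_type.intros Var_typed | simp)+
  then show ?case
    using Succ by (auto intro: has_type.intros mapT_typed)
next
  case (Rec \<Gamma> t \<sigma> p q)
  let ?G = "map (trans_ty A) \<Gamma>"
  have t: "\<iota> # \<iota> # ?G \<turnstile> lift 0 (lift 0 (trans_tm A t)) : trans_ty A (\<iota> \<rightarrow>\<^sub>T \<sigma> \<rightarrow>\<^sub>T \<sigma>)"
    using lift_typed[of "[]" "\<iota> # ?G"] lift_typed[of "[]" ?G] Rec.IH(1) by fastforce
  have p: "\<iota> # ?G \<turnstile> lift 0 (trans_tm A p) : trans_ty A \<sigma>"
    using lift_typed[of "[]" ?G] Rec.IH(2) by fastforce
  have e: "\<iota> # \<iota> # ?G \<turnstile> etaT A \<iota> \<cdot> Var 0 : trans_ty A \<iota>"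
    by (auto intro!: has_type.App[OF etaT_typed] Var_typed)
  have "?G \<turnstile> Lam \<iota> (Rec (trans_ty A \<sigma>)
      (Lam \<iota> (lift 0 (lift 0 (trans_tm A t)) \<cdot> (etaT A \<iota> \<cdot> Var 0)))
      (lift 0 (trans_tm A p)) (Var 0)) : \<iota> \<rightarrow>\<^sub>T trans_ty A \<sigma>"
    using has_type.App[OF t[unfolded trans_ty.simps(2)] e] p
    by (intro has_type.Lam has_type.Rec Var_typed) auto
  then show ?case
    using has_type.App[OF has_type.App[OF extT_typed] Rec.IH(3)] by simp
qed (auto intro: has_type.intros)

lemma dialogue_tree_typed:
  assumes "[] \<turnstile> t : (\<iota> \<rightarrow>\<^sub>T \<iota>) \<rightarrow>\<^sub>T \<iota>"
  shows "[] \<turnstile> dialogue_tree A t : ChD A \<iota>"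
proof -
  have "[] \<turnstile> genericT A : ChD A \<iota> \<rightarrow>\<^sub>T ChD A \<iota>"
    unfolding genericT_def
    by (rule has_type.App[OF kleisliT_typed] has_type.Lam
        has_type.App[OF has_type.App[OF betaT_typed etaT_typed]] Var_typed | simp)+
  then show ?thesis
    using trans_tm_typed[OF assms, of A] unfolding dialogue_tree_def
    by (auto intro: has_type.App)
qed


section \<open>The modulus term\<close>

text \<open>The parameter \<open>maxT\<close> is the chosen closed term for the maximum of two numbers; being
  closed, it needs no weakening under binders.\<close>

text \<open>\<open>\<lambda>d \<alpha>. d (\<lambda>w. zero) (\<lambda>g x. max x (g (\<alpha> x)))\<close>\<close>
definition maxQT :: "tm \<Rightarrow> tm" where
  "maxQT maxT = Lam (ChD \<iota> \<iota>) (Lam (\<iota> \<rightarrow>\<^sub>T \<iota>)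
    (Var 1 \<cdot> Lam \<iota> Zero \<cdot>
      Lam (\<iota> \<rightarrow>\<^sub>T \<iota>) (Lam \<iota> (maxT \<cdot> Var 0 \<cdot> (Var 1 \<cdot> (Var 2 \<cdot> Var 0))))))"

text \<open>\<open>\<lambda>d \<alpha>. succ (maxQ d \<alpha>)\<close>\<close>
definition modulusT :: "tm \<Rightarrow> tm" where
  "modulusT maxT = Lam (ChD \<iota> \<iota>) (Lam (\<iota> \<rightarrow>\<^sub>T \<iota>) (Succ (maxQT maxT \<cdot> Var 1 \<cdot> Var 0)))"

lemma modulusT_typed:
  assumes "\<And>\<Gamma>. \<Gamma> \<turnstile> maxT : \<iota> \<rightarrow>\<^sub>T \<iota> \<rightarrow>\<^sub>T \<iota>"
  shows "\<Gamma> \<turnstile> modulusT maxT : ChD \<iota> \<iota> \<rightarrow>\<^sub>T (\<iota> \<rightarrow>\<^sub>T \<iota>) \<rightarrow>\<^sub>T \<iota>"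
  unfolding modulusT_def maxQT_def ChD_def
  by (rule assms has_type.intros Var_typed | simp)+

definition is_max_term :: "'u universe \<Rightarrow> tm \<Rightarrow> bool" where
  "is_max_term U maxT \<longleftrightarrow> [] \<turnstile> maxT : \<iota> \<rightarrow>\<^sub>T \<iota> \<rightarrow>\<^sub>T \<iota> \<and>
    (\<forall>a b. ap U (ap U (sem U maxT []) (num U a)) (num U b) = num U (max a b))"

definition modulus_of_continuity_at :: "((nat \<Rightarrow> nat) \<Rightarrow> nat) \<Rightarrow> (nat \<Rightarrow> nat) \<Rightarrow> nat \<Rightarrow> bool" where
  "modulus_of_continuity_at f \<alpha> m \<longleftrightarrow> (\<forall>\<beta>. (\<forall>i<m. \<alpha> i = \<beta> i) \<longrightarrow> f \<alpha> = f \<beta>)"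

end

theory Submission
  imports Defs
begin

text \<open>
  A logical relation connects elements of a type that depend on an oracle \<open>\<alpha>\<close> with elements of the
  translated type: at \<open>\<iota>\<close>, some inductive dialogue tree computes the former for every \<open>\<alpha>\<close> and is
  Church-encoded by the latter.  Every term is related to its translation, and the oracle
  itself to the generic sequence, so the functional denoted by \<open>t\<close> is computed by a tree whose
  encoding is the internal dialogue tree.  Instantiating the encoding with the arguments chosen in \<open>maxQT\<close>
  yields the largest query along the path selected by \<open>\<alpha>\<close>, and a tree evaluates equally at
  oracles that agree on all queries of that path.

  Since the universe supports only the types occurring in the given terms, every
  \<open>\<beta>\<close>-step needs the type of its abstraction among these; \<open>supported\<close> carries this side condition.
\<close>

section \<open>Soundness of the interpretation for supported terms\<close>

definition supported :: "'u universe \<Rightarrow> ty list \<Rightarrow> tm \<Rightarrow> ty \<Rightarrow> bool" where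
  "supported U \<Gamma> t \<tau> \<longleftrightarrow> \<Gamma> \<turnstile> t : \<tau> \<and> (\<forall>\<sigma> \<in> term_types \<Gamma> t. supports U \<sigma>)"

definition env :: "'u universe \<Rightarrow> ty list \<Rightarrow> 'u list \<Rightarrow> bool" where
  "env U \<Gamma> \<gamma> \<longleftrightarrow> list_all2 (\<lambda>x \<sigma>. x \<in> elems U \<sigma>) \<gamma> \<Gamma>"

declare elems.simps(2) [simp del] supports.simps(2) [simp del] sem.simps(5) [simp del]

section \<open>Inversion of typing and syntax-directed rules for support\<close>

lemma has_type_iffs:
  "\<Gamma> \<turnstile> Var i : \<tau> \<longleftrightarrow> i < length \<Gamma> \<and> \<tau> = \<Gamma> ! i"
  "\<Gamma> \<turnstile> Zero : \<tau> \<longleftrightarrow> \<tau> = \<iota>"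
  "\<Gamma> \<turnstile> Succ t : \<tau> \<longleftrightarrow> \<tau> = \<iota> \<and> \<Gamma> \<turnstile> t : \<iota>"
  "\<Gamma> \<turnstile> Rec \<sigma> t p q : \<tau> \<longleftrightarrow>
    \<tau> = \<sigma> \<and> \<Gamma> \<turnstile> t : \<iota> \<rightarrow>\<^sub>T \<sigma> \<rightarrow>\<^sub>T \<sigma> \<and> \<Gamma> \<turnstile> p : \<sigma> \<and> \<Gamma> \<turnstile> q : \<iota>"
  "\<Gamma> \<turnstile> Lam \<sigma> t : \<tau> \<longleftrightarrow> (\<exists>\<tau>'. \<tau> = \<sigma> \<rightarrow>\<^sub>T \<tau>' \<and> \<sigma> # \<Gamma> \<turnstile> t : \<tau>')"
  "\<Gamma> \<turnstile> t \<cdot> u : \<tau> \<longleftrightarrow> (\<exists>\<sigma>. \<Gamma> \<turnstile> t : \<sigma> \<rightarrow>\<^sub>T \<tau> \<and> \<Gamma> \<turnstile> u : \<sigma>)"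
  by (auto elim: has_type.cases intro: has_type.intros)

lemma supported_typed: "supported U \<Gamma> t \<tau> \<Longrightarrow> \<Gamma> \<turnstile> t : \<tau>"
  by (simp add: supported_def)

lemma supported_supports: "supported U \<Gamma> t \<tau> \<Longrightarrow> supports U \<tau>"
  by (cases t) (auto simp: supported_def)

text \<open>The support condition does not mention the type, so the known typing of a combinator can
  replace an anonymous type left over from taking an application apart.\<close>

lemma supported_retype: "supported U \<Gamma> t \<tau>' \<Longrightarrow> \<Gamma> \<turnstile> t : \<tau> \<Longrightarrow> supported U \<Gamma> t \<tau>"
  by (simp add: supported_def)

lemma supported_Var [simp]: "supported U \<Gamma> (Var i) \<tau> \<longleftrightarrow> i < length \<Gamma> \<and> \<tau> = \<Gamma> ! i \<and> supports U \<tau>"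
  by (auto simp: supported_def has_type_iffs)

lemma supported_Zero [simp]: "supported U \<Gamma> Zero \<tau> \<longleftrightarrow> \<tau> = \<iota> \<and> supports U \<iota>"
  by (auto simp: supported_def has_type_iffs)

text \<open>The type of the whole term is also the type of an immediate subterm, so the right-hand
  side carries no \<open>supports\<close> conjunct; the same happens for \<open>Rec\<close> with its
  base term \<open>p\<close>.\<close>

lemma supported_Succ [simp]: "supported U \<Gamma> (Succ t) \<tau> \<longleftrightarrow> \<tau> = \<iota> \<and> supported U \<Gamma> t \<iota>"
  using supported_supports[of U \<Gamma> t \<iota>] by (auto simp: supported_def has_type_iffs)

lemma supported_Rec [simp]: "supported U \<Gamma> (Rec \<sigma> t p q) \<tau> \<longleftrightarrow>
    \<tau> = \<sigma> \<and> supported U \<Gamma> t (\<iota> \<rightarrow>\<^sub>T \<sigma> \<rightarrow>\<^sub>T \<sigma>) \<and> supported U \<Gamma> p \<sigma> \<and> supported U \<Gamma> q \<iota>"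
  using supported_supports[of U \<Gamma> p \<sigma>] by (auto simp: supported_def has_type_iffs)

lemma supported_Lam [simp]: "supported U \<Gamma> (Lam \<sigma> t) \<tau> \<longleftrightarrow>
    (\<exists>\<tau>'. \<tau> = \<sigma> \<rightarrow>\<^sub>T \<tau>' \<and> supports U \<tau> \<and> supported U (\<sigma> # \<Gamma>) t \<tau>')"
  by (auto simp: supported_def has_type_iffs dest: type_unique)

lemma supported_App [simp]: "supported U \<Gamma> (t \<cdot> u) \<tau> \<longleftrightarrow>
    (\<exists>\<sigma>. supported U \<Gamma> t (\<sigma> \<rightarrow>\<^sub>T \<tau>) \<and> supported U \<Gamma> u \<sigma> \<and> supports U \<tau>)"
  by (auto simp: supported_def has_type_iffs dest: type_unique)

lemma supported_LamD: "supported U \<Gamma> (Lam \<sigma> t) (\<sigma> \<rightarrow>\<^sub>T \<tau>) \<Longrightarrow> supported U (\<sigma> # \<Gamma>) t \<tau>"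
  by simp

text \<open>\<open>supported_App\<close> yields only some argument type; a known typing of the head
  determines it by \<open>type_unique\<close>.\<close>

lemma supported_AppD:
  assumes "supported U \<Gamma> (t \<cdot> u) \<rho>" "\<Gamma> \<turnstile> t : \<sigma> \<rightarrow>\<^sub>T \<tau>"
  shows "supported U \<Gamma> t (\<sigma> \<rightarrow>\<^sub>T \<tau>)" "supported U \<Gamma> u \<sigma>"
proof -
  obtain \<sigma>' where "supported U \<Gamma> t (\<sigma>' \<rightarrow>\<^sub>T \<rho>)" "supported U \<Gamma> u \<sigma>'"
    using assms(1) by auto
  then show "supported U \<Gamma> t (\<sigma> \<rightarrow>\<^sub>T \<tau>)" "supported U \<Gamma> u \<sigma>"
    using type_unique[OF assms(2) supported_typed] by blast+
qed

section \<open>Environments, function codes and soundness of typing\<close>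

lemma env_simps [simp]:
  "env U [] \<gamma> \<longleftrightarrow> \<gamma> = []"
  "env U (\<sigma> # \<Gamma>) (x # \<gamma>) \<longleftrightarrow> x \<in> elems U \<sigma> \<and> env U \<Gamma> \<gamma>"
  by (auto simp: env_def)

lemma env_Cons: "env U \<Gamma> \<gamma> \<Longrightarrow> x \<in> elems U \<sigma> \<Longrightarrow> env U (\<sigma> # \<Gamma>) (x # \<gamma>)"
  by simp

lemma env_nth: "env U \<Gamma> \<gamma> \<Longrightarrow> i < length \<Gamma> \<Longrightarrow> \<gamma> ! i \<in> elems U (\<Gamma> ! i)"
  by (auto simp: env_def list_all2_conv_all_nth)

lemma to_nat_num [simp]: "supports U \<iota> \<Longrightarrow> to_nat U (num U n) = n"
  by (simp add: to_nat_def)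

lemma supports_FunD:
  assumes "supports U (\<sigma> \<rightarrow>\<^sub>T \<tau>)"
  shows "supports U \<sigma>" "supports U \<tau>"
  using assms by (simp_all add: supports.simps)

lemma fun_code_in:
  assumes "\<And>x. x \<in> elems U \<sigma> \<Longrightarrow> f x \<in> elems U \<tau>"
  shows "fun_code U (elems U \<sigma>) (\<lambda>x \<in> elems U \<sigma>. f x) \<in> elems U (\<sigma> \<rightarrow>\<^sub>T \<tau>)"
  using assms by (auto simp: elems.simps)

lemma ap_fun_code:
  assumes "supports U (\<sigma> \<rightarrow>\<^sub>T \<tau>)" and f: "\<And>x. x \<in> elems U \<sigma> \<Longrightarrow> f x \<in> elems U \<tau>"
    and x: "x \<in> elems U \<sigma>"
  shows "ap U (fun_code U (elems U \<sigma>) (\<lambda>x \<in> elems U \<sigma>. f x)) x = f x"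
proof -
  have "restrict f (elems U \<sigma>) \<in> elems U \<sigma> \<rightarrow>\<^sub>E elems U \<tau>"
    using f by auto
  then show ?thesis
    using assms(1) x by (simp add: supports.simps)
qed

text \<open>An element of a function type is by construction the code of an extensional function,
  and support evaluates \<open>ap\<close> on this code to the value of that function.\<close>

lemma ap_in:
  assumes "supports U (\<sigma> \<rightarrow>\<^sub>T \<tau>)" "f \<in> elems U (\<sigma> \<rightarrow>\<^sub>T \<tau>)" "x \<in> elems U \<sigma>"
  shows "ap U f x \<in> elems U \<tau>"
  using assms by (auto simp: elems.simps supports.simps)

lemma sem_in: "supported U \<Gamma> t \<tau> \<Longrightarrow> env U \<Gamma> \<gamma> \<Longrightarrow> sem U t \<gamma> \<in> elems U \<tau>"
proof (induction t arbitrary: \<Gamma> \<tau> \<gamma>)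
  case (Var i)
  then show ?case by (auto intro: env_nth)
next
  case (Rec \<sigma> t p q)
  then have g: "supported U \<Gamma> t (\<iota> \<rightarrow>\<^sub>T \<sigma> \<rightarrow>\<^sub>T \<sigma>)" "supported U \<Gamma> p \<sigma>" and "\<tau> = \<sigma>"
    by auto
  note s = supported_supports[OF g(1)]
  \<comment> \<open>The recursion argument denotes some number, so it suffices to place every
    iterate in the type.\<close>
  have "rec_nat (sem U p \<gamma>) (\<lambda>n r. ap U (ap U (sem U t \<gamma>) (num U n)) r) n \<in> elems U \<sigma>" for n
  proof (induction n)
    case 0
    show ?case using Rec.IH(2)[OF g(2) Rec.prems(2)] by simp
  next
    case (Suc n)
    have "ap U (sem U t \<gamma>) (num U n) \<in> elems U (\<sigma> \<rightarrow>\<^sub>T \<sigma>)"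
      using ap_in[OF s Rec.IH(1)[OF g(1) Rec.prems(2)]] by simp
    then show ?case
      using ap_in[OF supports_FunD(2)[OF s]] Suc by simp
  qed
  then show ?case using \<open>\<tau> = \<sigma>\<close> by simp
next
  case (Lam \<sigma> t)
  then show ?case
    by (auto simp: sem.simps(5) intro!: fun_code_in)
next
  case (App t u)
  then obtain \<sigma> where "supported U \<Gamma> t (\<sigma> \<rightarrow>\<^sub>T \<tau>)" "supported U \<Gamma> u \<sigma>"
    by auto
  then show ?case
    using App ap_in[OF supported_supports] by (metis sem.simps(6))
qed auto

text \<open>The \<beta>-rule behind all later evaluations: support of the abstraction makes
  \<open>fun_code\<close> faithful at its type, and \<open>sem_in\<close> for the body keeps the
  coded function inside the function space.\<close>

lemma ap_Lam:
  assumes "supported U \<Gamma> (Lam \<sigma> t) \<tau>" "env U \<Gamma> \<gamma>" "x \<in> elems U \<sigma>"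
  shows "ap U (sem U (Lam \<sigma> t) \<gamma>) x = sem U t (x # \<gamma>)"
proof -
  obtain \<tau>' where "supported U (\<sigma> # \<Gamma>) t \<tau>'" "supports U (\<sigma> \<rightarrow>\<^sub>T \<tau>')"
    using assms(1) by auto
  then show ?thesis
    using assms(2,3) by (auto simp: sem.simps(5) intro!: ap_fun_code sem_in)
qed

section \<open>Weakening\<close>

lemma sem_lift: "sem U (lift (length \<gamma>) t) (\<gamma> @ x # \<delta>) = sem U t (\<gamma> @ \<delta>)"
proof (induction t arbitrary: \<gamma>)
  case (Var i)
  then show ?case by (auto simp: nth_append Suc_diff_le)
next
  case (Lam \<sigma> t)
  have "sem U (lift (Suc (length \<gamma>)) t) (y # \<gamma> @ x # \<delta>) = sem U t (y # \<gamma> @ \<delta>)" for y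
    using Lam[of "y # \<gamma>"] by simp
  then show ?case by (simp add: sem.simps(5))
qed simp_all

lemma sem_lift0 [simp]: "sem U (lift 0 t) (x # \<delta>) = sem U t \<delta>"
  using sem_lift[of U "[]"] by simp

text \<open>The translated recursor contains the translations of its step and base terms only in
  lifted form; this inclusion carries support from the lifted copies back to the originals.\<close>

lemma term_types_lift: "term_types (\<Gamma> @ \<Delta>) t \<subseteq> term_types (\<Gamma> @ \<rho> # \<Delta>) (lift (length \<Gamma>) t)"
proof (induction t arbitrary: \<Gamma>)
  case (Var i)
  then show ?case by (auto simp: has_type_iffs nth_append Suc_diff_le)
next
  case (Succ t)
  then show ?case using lift_typed[of \<Gamma> \<Delta> "Succ t"] by fastforce
next
  case (Rec \<sigma> t p q)
  have "{\<tau>. \<Gamma> @ \<Delta> \<turnstile> Rec \<sigma> t p q : \<tau>} \<subseteq> {\<tau>. \<Gamma> @ \<rho> # \<Delta> \<turnstile> lift (length \<Gamma>) (Rec \<sigma> t p q) : \<tau>}"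
    using lift_typed by blast
  then show ?case using Rec[of \<Gamma>] by auto
next
  case (Lam \<sigma> t)
  have "{\<tau>. \<Gamma> @ \<Delta> \<turnstile> Lam \<sigma> t : \<tau>} \<subseteq> {\<tau>. \<Gamma> @ \<rho> # \<Delta> \<turnstile> lift (length \<Gamma>) (Lam \<sigma> t) : \<tau>}"
    using lift_typed by blast
  then show ?case using Lam[of "\<sigma> # \<Gamma>"] by auto
next
  case (App t u)
  have "{\<tau>. \<Gamma> @ \<Delta> \<turnstile> t \<cdot> u : \<tau>} \<subseteq> {\<tau>. \<Gamma> @ \<rho> # \<Delta> \<turnstile> lift (length \<Gamma>) (t \<cdot> u) : \<tau>}"
    using lift_typed by blast
  then show ?case using App[of \<Gamma>] by auto
qed (simp add: has_type_iffs)

lemma term_types_lift0: "term_types \<Delta> t \<subseteq> term_types (\<rho> # \<Delta>) (lift 0 t)"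
  using term_types_lift[of "[]"] by simp

text \<open>Appending at the far end of the context leaves all de Bruijn indices in place, so the
  term is unchanged. This is how the closed \<open>maxT\<close> is typed under binders.\<close>

lemma weaken: "\<Gamma> \<turnstile> t : \<tau> \<Longrightarrow> \<Gamma> @ \<Delta> \<turnstile> t : \<tau>"
proof (induction rule: has_type.induct)
  case (Var i \<Gamma>)
  then show ?case by (simp add: has_type_iffs nth_append)
qed (auto intro: has_type.intros)

lemma weaken_closed: "[] \<turnstile> t : \<tau> \<Longrightarrow> \<Gamma> \<turnstile> t : \<tau>"
  using weaken[of "[]" t \<tau> \<Gamma>] by simp

lemma genericT_typed: "\<Gamma> \<turnstile> genericT A : ChD A \<iota> \<rightarrow>\<^sub>T ChD A \<iota>"
  unfolding genericT_def
  by (rule has_type.App[OF kleisliT_typed] has_type.Lam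
      has_type.App[OF has_type.App[OF betaT_typed etaT_typed]] Var_typed | simp)+

text \<open>For empty \<open>\<Gamma>\<close> the hypothesis is vacuous, so a closed term such as
  \<open>maxT\<close> has the same value in every environment.\<close>

lemma sem_env_cong:
  "\<Gamma> \<turnstile> t : \<tau> \<Longrightarrow> \<forall>i < length \<Gamma>. \<gamma> ! i = \<delta> ! i \<Longrightarrow> sem U t \<gamma> = sem U t \<delta>"
proof (induction arbitrary: \<gamma> \<delta> rule: has_type.induct)
  case (Succ \<Gamma> t)
  show ?case by (simp add: Succ.IH[OF Succ.prems])
next
  case (Rec \<Gamma> t \<sigma> p q)
  show ?case by (simp add: Rec.IH[OF Rec.prems])
next
  case (Lam \<sigma> \<Gamma> t \<tau>)
  have "sem U t (x # \<gamma>) = sem U t (x # \<delta>)" for x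
    by (rule Lam.IH) (use Lam.prems in \<open>simp add: nth_Cons split: nat.splits\<close>)
  then show ?case by (simp add: sem.simps(5))
next
  case (App \<Gamma> t \<sigma> \<tau> u)
  show ?case by (simp add: App.IH[OF App.prems])
qed simp_all


section \<open>Evaluation of the internal combinators\<close>

text \<open>One \<open>ap_Lam\<close> per binder: each abstraction is peeled off the support fact
  while the environment grows by the matching argument. The evaluation lemmas below follow the same
  pattern.\<close>

lemma eta_apply:
  assumes g: "supported U \<Delta> (etaT A \<sigma>) \<rho>" and env: "env U \<Delta> \<delta>" and z: "z \<in> elems U \<sigma>"
    and e: "e \<in> elems U (\<sigma> \<rightarrow>\<^sub>T A)" and b: "b \<in> elems U (BrT A)"
  shows "ap U (ap U (ap U (sem U (etaT A \<sigma>) \<delta>) z) e) b = ap U e z"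
proof -
  note g0 = supported_retype[OF g etaT_typed, unfolded etaT_def ChD_def]
  note g1 = supported_LamD[OF g0] and env1 = env_Cons[OF env z]
  note g2 = supported_LamD[OF g1] and env2 = env_Cons[OF env1 e]
  show ?thesis
    unfolding etaT_def ap_Lam[OF g0 env z] ap_Lam[OF g1 env1 e] ap_Lam[OF g2 env2 b] by simp
qed

text \<open>The witness \<open>c\<close> is the denotation of the inner abstraction
  \<open>\<lambda>x. f x e' b'\<close>. Only its values on the type matter later, so it is exported
  abstractly as the leaf argument passed to \<open>d\<close>.\<close>

lemma kleisli_apply:
  assumes g: "supported U \<Delta> (kleisliT A \<sigma> \<tau>) \<rho>" and env: "env U \<Delta> \<delta>"
    and G: "G \<in> elems U (\<sigma> \<rightarrow>\<^sub>T ChD A \<tau>)" and d: "d \<in> elems U (ChD A \<sigma>)"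
    and e: "e \<in> elems U (\<tau> \<rightarrow>\<^sub>T A)" and b: "b \<in> elems U (BrT A)"
  obtains c where "c \<in> elems U (\<sigma> \<rightarrow>\<^sub>T A)"
    "\<And>x. x \<in> elems U \<sigma> \<Longrightarrow> ap U c x = ap U (ap U (ap U G x) e) b"
    "ap U (ap U (ap U (ap U (sem U (kleisliT A \<sigma> \<tau>) \<delta>) G) d) e) b = ap U (ap U d c) b"
proof -
  let ?\<delta>4 = "b # e # d # G # \<delta>"
  let ?inner = "Lam \<sigma> (Var 4 \<cdot> Var 0 \<cdot> Var 2 \<cdot> Var 1)"
  note g0 = supported_retype[OF g kleisliT_typed, unfolded kleisliT_def ChD_def]
  note G = G[unfolded ChD_def] and d = d[unfolded ChD_def]
  note g1 = supported_LamD[OF g0] and env1 = env_Cons[OF env G]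
  note g2 = supported_LamD[OF g1] and env2 = env_Cons[OF env1 d]
  note g3 = supported_LamD[OF g2] and env3 = env_Cons[OF env2 e]
  note g4 = supported_LamD[OF g3] and env4 = env_Cons[OF env3 b]
  have gi: "supported U (BrT A # (\<tau> \<rightarrow>\<^sub>T A) # ((\<sigma> \<rightarrow>\<^sub>T A) \<rightarrow>\<^sub>T BrT A \<rightarrow>\<^sub>T A)
      # (\<sigma> \<rightarrow>\<^sub>T (\<tau> \<rightarrow>\<^sub>T A) \<rightarrow>\<^sub>T BrT A \<rightarrow>\<^sub>T A) # \<Delta>) ?inner (\<sigma> \<rightarrow>\<^sub>T A)"
    using g4 by auto
  show ?thesis
  proof
    show "sem U ?inner ?\<delta>4 \<in> elems U (\<sigma> \<rightarrow>\<^sub>T A)"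
      by (rule sem_in[OF gi env4])
    show "ap U (sem U ?inner ?\<delta>4) x = ap U (ap U (ap U G x) e) b" if "x \<in> elems U \<sigma>" for x
      unfolding ap_Lam[OF gi env4 that] by simp
    show "ap U (ap U (ap U (ap U (sem U (kleisliT A \<sigma> \<tau>) \<delta>) G) d) e) b
        = ap U (ap U d (sem U ?inner ?\<delta>4)) b"
      unfolding kleisliT_def ChD_def ap_Lam[OF g0 env G] ap_Lam[OF g1 env1 d]
        ap_Lam[OF g2 env2 e] ap_Lam[OF g3 env3 b] by simp
  qed
qed

text \<open>Unfolds one arrow of the recursion defining \<open>extT\<close>. The inner
  \<open>extT A \<tau>\<close> sits under three binders, so context and environment change and are
  existential; \<open>G'\<close> denotes \<open>\<lambda>x. f x s\<close> with \<open>s\<close>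
  bound to \<open>y\<close>.\<close>

lemma ext_apply:
  assumes g: "supported U \<Delta> (extT A (\<sigma> \<rightarrow>\<^sub>T \<tau>)) \<rho>" and env: "env U \<Delta> \<delta>"
    and G: "G \<in> elems U (\<iota> \<rightarrow>\<^sub>T trans_ty A (\<sigma> \<rightarrow>\<^sub>T \<tau>))" and d: "d \<in> elems U (trans_ty A \<iota>)"
    and y: "y \<in> elems U (trans_ty A \<sigma>)"
  obtains \<Delta>' \<delta>' \<rho>' G' where "supported U \<Delta>' (extT A \<tau>) \<rho>'" "env U \<Delta>' \<delta>'"
    "G' \<in> elems U (\<iota> \<rightarrow>\<^sub>T trans_ty A \<tau>)" "\<And>n. ap U G' (num U n) = ap U (ap U G (num U n)) y"
    "ap U (ap U (ap U (sem U (extT A (\<sigma> \<rightarrow>\<^sub>T \<tau>)) \<delta>) G) d) y = ap U (ap U (sem U (extT A \<tau>) \<delta>') G') d"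
proof -
  let ?\<delta>3 = "y # d # G # \<delta>"
  let ?inner = "Lam \<iota> (Var 3 \<cdot> Var 0 \<cdot> Var 1)"
  note G' = G[unfolded trans_ty.simps(2)]
  note g0 = supported_retype[OF g extT_typed, unfolded extT.simps trans_ty.simps(2)]
  note g1 = supported_LamD[OF g0] and env1 = env_Cons[OF env G']
  note g2 = supported_LamD[OF g1] and env2 = env_Cons[OF env1 d]
  note g3 = supported_LamD[OF g2] and env3 = env_Cons[OF env2 y]
  \<comment> \<open>Fixing \<open>u\<close> splits off only the outermost argument and keeps the
    application of \<open>extT\<close> intact.\<close>
  from g3 obtain \<rho>' where g4: "supported U (trans_ty A \<sigma> # trans_ty A \<iota>
      # (\<iota> \<rightarrow>\<^sub>T trans_ty A \<sigma> \<rightarrow>\<^sub>T trans_ty A \<tau>) # \<Delta>) (extT A \<tau> \<cdot> ?inner) \<rho>'"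
    unfolding supported_App[where u = "Var 1"] by blast
  note gext = supported_AppD(1)[OF g4 extT_typed] and gi = supported_AppD(2)[OF g4 extT_typed]
  show ?thesis
  proof
    show "ap U (sem U ?inner ?\<delta>3) (num U n) = ap U (ap U G (num U n)) y" for n
      using ap_Lam[OF gi env3, of "num U n"] by simp
    show "ap U (ap U (ap U (sem U (extT A (\<sigma> \<rightarrow>\<^sub>T \<tau>)) \<delta>) G) d) y
        = ap U (ap U (sem U (extT A \<tau>) ?\<delta>3) (sem U ?inner ?\<delta>3)) d"
      unfolding extT.simps trans_ty.simps(2) ap_Lam[OF g0 env G'] ap_Lam[OF g1 env1 d]
        ap_Lam[OF g2 env2 y] by simp
  qed (fact gext env3 sem_in[OF gi env3])+
qed

text \<open>A single query at \<open>n\<close>: the subtrees given to \<open>betaT\<close> are the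
  \<eta> y, so by \<open>eta_apply\<close> the continuation \<open>\<lambda>y. \<eta> y e b\<close>
  agrees with \<open>e\<close> on \<iota> and has the code shown.\<close>

lemma beta_eta_apply:
  assumes g: "supported U \<Delta> (betaT A \<iota> \<cdot> etaT A \<iota> \<cdot> Var 0) \<tau>" and env: "env U \<Delta> (num U n # \<delta>)"
    and e: "e \<in> elems U (\<iota> \<rightarrow>\<^sub>T A)" and b: "b \<in> elems U (BrT A)"
  shows "ap U (ap U (sem U (betaT A \<iota> \<cdot> etaT A \<iota> \<cdot> Var 0) (num U n # \<delta>)) e) b
    = ap U (ap U b (fun_code U (elems U \<iota>) (\<lambda>y \<in> elems U \<iota>. ap U e y))) (num U n)"
proof -
  let ?\<delta> = "num U n # \<delta>"
  let ?eta = "sem U (etaT A \<iota>) ?\<delta>"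
  let ?inner = "Lam \<iota> (Var 4 \<cdot> Var 0 \<cdot> Var 2 \<cdot> Var 1)"
  obtain \<rho> where gbe: "supported U \<Delta> (betaT A \<iota> \<cdot> etaT A \<iota>) \<rho>"
    using g unfolding supported_App[where u = "Var 0"] by blast
  note ge = supported_AppD(2)[OF gbe betaT_typed]
  note g0 = supported_AppD(1)[OF gbe betaT_typed, unfolded betaT_def ChD_def]
  note eta = sem_in[OF ge env, unfolded ChD_def]
  have n: "num U n \<in> elems U \<iota>" by simp
  note g1 = supported_LamD[OF g0] and env1 = env_Cons[OF env eta]
  note g2 = supported_LamD[OF g1] and env2 = env_Cons[OF env1 n]
  note g3 = supported_LamD[OF g2] and env3 = env_Cons[OF env2 e]
  have inner: "sem U ?inner (b # e # num U n # ?eta # ?\<delta>)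
      = fun_code U (elems U \<iota>) (\<lambda>y \<in> elems U \<iota>. ap U e y)"
    unfolding sem.simps(5)
    by (intro arg_cong[where f = "fun_code U _"] restrict_ext) (simp add: eta_apply[OF ge env _ e b])
  have "sem U (betaT A \<iota> \<cdot> etaT A \<iota> \<cdot> Var 0) ?\<delta>
      = sem U (Lam (\<iota> \<rightarrow>\<^sub>T A) (Lam (BrT A) (Var 0 \<cdot> ?inner \<cdot> Var 2))) (num U n # ?eta # ?\<delta>)"
    unfolding sem.simps(6) betaT_def ChD_def ap_Lam[OF g0 env eta] sem.simps(1) nth_Cons_0
      ap_Lam[OF g1 env1 n] ..
  then show ?thesis
    using ap_Lam[OF g2 env2 e] ap_Lam[OF g3 env3 b] inner by simp
qed

section \<open>The coded oracle and the modulus term\<close>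

lemma seq_code_in: "seq_code U \<alpha> \<in> elems U (\<iota> \<rightarrow>\<^sub>T \<iota>)"
  unfolding seq_code_def by (rule fun_code_in) simp

lemma ap_seq_code:
  assumes "supports U (\<iota> \<rightarrow>\<^sub>T \<iota>)"
  shows "ap U (seq_code U \<alpha>) (num U n) = num U (\<alpha> n)"
  using ap_fun_code[OF assms, of "\<lambda>x. num U (\<alpha> (to_nat U x))" "num U n"] supports_FunD[OF assms]
  by (simp add: seq_code_def)

text \<open>\<open>e\<close> and \<open>b\<close> are the denotations of the two arguments that
  \<open>maxQT\<close> gives to the tree. Exporting just their laws frees the later induction on
  trees from all syntax.\<close>

lemma modulus_apply:
  assumes g: "supported U [] (modulusT maxT \<cdot> t) \<tau>" and max: "is_max_term U maxT"
    and d: "sem U t [] \<in> elems U (ChD \<iota> \<iota>)"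
  obtains e b where "e \<in> elems U (\<iota> \<rightarrow>\<^sub>T \<iota>)" "b \<in> elems U (BrT \<iota>)" "\<And>n. ap U e (num U n) = num U 0"
    "\<And>g x y. g \<in> elems U (\<iota> \<rightarrow>\<^sub>T \<iota>) \<Longrightarrow> ap U g (num U (\<alpha> x)) = num U y \<Longrightarrow>
      ap U (ap U b g) (num U x) = num U (max x y)"
    "functional U (modulusT maxT \<cdot> t) \<alpha> = Suc (to_nat U (ap U (ap U (sem U t []) e) b))"
proof -
  let ?d = "sem U t []" and ?s = "seq_code U \<alpha>"
  let ?succ = "Succ (maxQT maxT \<cdot> Var 1 \<cdot> Var 0)"
  let ?zero = "Lam \<iota> Zero"
  let ?max = "maxT \<cdot> Var 0 \<cdot> (Var 1 \<cdot> (Var 2 \<cdot> Var 0))"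
  let ?step = "Lam (\<iota> \<rightarrow>\<^sub>T \<iota>) (Lam \<iota> ?max)"
  let ?query = "Var 1 \<cdot> ?zero \<cdot> ?step"
  let ?\<Gamma>2 = "[\<iota> \<rightarrow>\<^sub>T \<iota>, ChD \<iota> \<iota>]"
  let ?\<Gamma>4 = "(\<iota> \<rightarrow>\<^sub>T \<iota>) # ChD \<iota> \<iota> # ?\<Gamma>2"
  \<comment> \<open>\<open>modulusT\<close> and \<open>maxQT\<close> each bind the tree and the
    oracle, so both occur twice.\<close>
  let ?\<gamma>4 = "[?s, ?d, ?s, ?d]"
  obtain \<rho> where gm: "supported U [] (Lam (ChD \<iota> \<iota>) (Lam (\<iota> \<rightarrow>\<^sub>T \<iota>) ?succ)) \<rho>"
    using g unfolding modulusT_def supported_App by blast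
  then have gs: "supported U [ChD \<iota> \<iota>] (Lam (\<iota> \<rightarrow>\<^sub>T \<iota>) ?succ) ((\<iota> \<rightarrow>\<^sub>T \<iota>) \<rightarrow>\<^sub>T \<iota>)"
    by auto
  then obtain \<rho>' where "supported U ?\<Gamma>2 (maxQT maxT) \<rho>'"
    by auto
  note gq = this[unfolded maxQT_def]
  obtain \<rho>'' where gq2: "supported U (ChD \<iota> \<iota> # ?\<Gamma>2) (Lam (\<iota> \<rightarrow>\<^sub>T \<iota>) ?query) \<rho>''"
    using gq unfolding supported_Lam[where \<sigma> = "ChD \<iota> \<iota>"] by blast
  have gz: "supported U ?\<Gamma>4 ?zero (\<iota> \<rightarrow>\<^sub>T \<iota>)" and gst: "supported U ?\<Gamma>4 ?step (BrT \<iota>)"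
    using gq2 by (auto simp: ChD_def)
  note gst2 = supported_LamD[OF gst]
  note sii = supported_supports[OF gz] and si = supports_FunD(1)[OF supported_supports[OF gz]]
  note s = seq_code_in[of U \<alpha>]
  have maxT: "sem U maxT \<gamma> = sem U maxT []" for \<gamma>
    by (rule sem_env_cong[of "[]" maxT]) (use max in \<open>auto simp: is_max_term_def\<close>)
  have env4: "env U ?\<Gamma>4 ?\<gamma>4" using s d by simp
  show ?thesis
  proof
    show "sem U ?zero ?\<gamma>4 \<in> elems U (\<iota> \<rightarrow>\<^sub>T \<iota>)" by (rule sem_in[OF gz env4])
    show "sem U ?step ?\<gamma>4 \<in> elems U (BrT \<iota>)" by (rule sem_in[OF gst env4])
    show "ap U (sem U ?zero ?\<gamma>4) (num U n) = num U 0" for n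
      using ap_Lam[OF gz env4, of "num U n"] by simp
    show "ap U (ap U (sem U ?step ?\<gamma>4) g) (num U x) = num U (max x y)"
      if g: "g \<in> elems U (\<iota> \<rightarrow>\<^sub>T \<iota>)" and y: "ap U g (num U (\<alpha> x)) = num U y" for g x y
    proof -
      have "ap U (ap U (sem U ?step ?\<gamma>4) g) (num U x) = sem U ?max (num U x # g # ?\<gamma>4)"
        using ap_Lam[OF gst env4 g] ap_Lam[OF gst2 env_Cons[OF env4 g], of "num U x"] by simp
      also have "\<dots> = ap U (ap U (sem U maxT []) (num U x)) (ap U g (num U (\<alpha> x)))"
        unfolding sem.simps(6) maxT[of "num U x # g # ?\<gamma>4"] by (simp add: ap_seq_code[OF sii])
      finally show ?thesis
        using y max by (simp add: is_max_term_def)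
    qed
    have 1: "sem U (modulusT maxT \<cdot> t) [] = sem U (Lam (\<iota> \<rightarrow>\<^sub>T \<iota>) ?succ) [?d]"
      unfolding sem.simps(6) modulusT_def by (rule ap_Lam[OF gm _ d]) simp
    have 2: "ap U (sem U (Lam (\<iota> \<rightarrow>\<^sub>T \<iota>) ?succ) [?d]) ?s = sem U ?succ [?s, ?d]"
      by (rule ap_Lam[OF gs _ s]) (simp add: d)
    have 3: "ap U (sem U (maxQT maxT) [?s, ?d]) ?d = sem U (Lam (\<iota> \<rightarrow>\<^sub>T \<iota>) ?query) [?d, ?s, ?d]"
      unfolding maxQT_def by (rule ap_Lam[OF gq _ d]) (simp add: s d)
    have 4: "ap U (sem U (Lam (\<iota> \<rightarrow>\<^sub>T \<iota>) ?query) [?d, ?s, ?d]) ?s = sem U ?query ?\<gamma>4"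
      by (rule ap_Lam[OF gq2 _ s]) (simp add: s d)
    have "functional U (modulusT maxT \<cdot> t) \<alpha>
        = Suc (to_nat U (ap U (ap U (sem U (maxQT maxT) [?s, ?d]) ?d) ?s))"
      unfolding functional_def 1 2 using si by simp
    then show "functional U (modulusT maxT \<cdot> t) \<alpha>
        = Suc (to_nat U (ap U (ap U ?d (sem U ?zero ?\<gamma>4)) (sem U ?step ?\<gamma>4)))"
      unfolding 3 4 by simp
  qed
qed


section \<open>External dialogue trees\<close>

datatype dtree = Leaf nat | Node "nat \<Rightarrow> dtree" nat

primrec dialogue :: "dtree \<Rightarrow> (nat \<Rightarrow> nat) \<Rightarrow> nat" where
  "dialogue (Leaf n) \<alpha> = n"
| "dialogue (Node \<phi> x) \<alpha> = dialogue (\<phi> (\<alpha> x)) \<alpha>"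

text \<open>The external counterpart of \<open>kleisliT\<close>.\<close>

primrec bind :: "dtree \<Rightarrow> (nat \<Rightarrow> dtree) \<Rightarrow> dtree" where
  "bind (Leaf n) k = k n"
| "bind (Node \<phi> x) k = Node (\<lambda>y. bind (\<phi> y) k) x"

lemma dialogue_bind: "dialogue (bind D k) \<alpha> = dialogue (k (dialogue D \<alpha>)) \<alpha>"
  by (induction D) simp_all

text \<open>The fold of a tree with leaf argument \<open>e\<close> and branch argument
  \<open>b\<close>, carried out inside the universe; \<open>b\<close> expects an element there, so
  the family of subtree values is coded as a function.\<close>

primrec church :: "'u universe \<Rightarrow> 'u \<Rightarrow> 'u \<Rightarrow> dtree \<Rightarrow> 'u" where
  "church U e b (Leaf n) = ap U e (num U n)"
| "church U e b (Node \<phi> x) =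
    ap U (ap U b (fun_code U (elems U \<iota>) (\<lambda>y \<in> elems U \<iota>. church U e b (\<phi> (to_nat U y)))))
      (num U x)"

text \<open>Grafting trees at the leaves only changes the leaf argument of the fold. The element
  \<open>c\<close> of \<open>kleisli_apply\<close> takes the place of \<open>e'\<close>.\<close>

lemma church_bind:
  assumes "\<And>n. ap U e' (num U n) = church U e b (k n)"
  shows "church U e b (bind D k) = church U e' b D"
  by (induction D) (simp_all add: assms)


section \<open>The logical relation\<close>

text \<open>The first argument related is an element depending on the oracle, the second an element of the
  translated type.\<close>

primrec rel ::
  "'u universe \<Rightarrow> ty \<Rightarrow> ty \<Rightarrow> ((nat \<Rightarrow> nat) \<Rightarrow> 'u) \<Rightarrow> 'u \<Rightarrow> bool" where
  "rel U A \<iota> f d \<longleftrightarrow> d \<in> elems U (trans_ty A \<iota>) \<and>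
    (\<exists>D. (\<forall>\<alpha>. f \<alpha> = num U (dialogue D \<alpha>)) \<and>
      (\<forall>e \<in> elems U (\<iota> \<rightarrow>\<^sub>T A). \<forall>b \<in> elems U (BrT A). ap U (ap U d e) b = church U e b D))"
| "rel U A (\<sigma> \<rightarrow>\<^sub>T \<tau>) f d \<longleftrightarrow>
    (\<forall>\<alpha>. f \<alpha> \<in> elems U (\<sigma> \<rightarrow>\<^sub>T \<tau>)) \<and> d \<in> elems U (trans_ty A (\<sigma> \<rightarrow>\<^sub>T \<tau>)) \<and>
    (\<forall>x y. rel U A \<sigma> x y \<longrightarrow> rel U A \<tau> (\<lambda>\<alpha>. ap U (f \<alpha>) (x \<alpha>)) (ap U d y))"

lemma rel_in:
  assumes "rel U A \<sigma> f d"
  shows "f \<alpha> \<in> elems U \<sigma>" "d \<in> elems U (trans_ty A \<sigma>)"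
  using assms by (cases \<sigma>; auto)+

lemma rel_FunD:
  "rel U A (\<sigma> \<rightarrow>\<^sub>T \<tau>) f d \<Longrightarrow> rel U A \<sigma> x y \<Longrightarrow> rel U A \<tau> (\<lambda>\<alpha>. ap U (f \<alpha>) (x \<alpha>)) (ap U d y)"
  by simp

lemma rel_eta:
  assumes g: "supported U \<Delta> (etaT A \<iota>) \<tau>" and env: "env U \<Delta> \<delta>"
  shows "rel U A \<iota> (\<lambda>_. num U n) (ap U (sem U (etaT A \<iota>) \<delta>) (num U n))"
proof -
  note g' = supported_retype[OF g etaT_typed]
  have "ap U (sem U (etaT A \<iota>) \<delta>) (num U n) \<in> elems U (ChD A \<iota>)"
    using ap_in[OF supported_supports[OF g'] sem_in[OF g' env]] by simp
  then show ?thesis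
    using eta_apply[OF g env, of "num U n"] by (auto intro!: exI[of _ "Leaf n"])
qed

text \<open>The witness is the tree of \<open>q\<close> with the trees of the \<open>F n\<close>
  grafted on: \<open>dialogue_bind\<close> gives its value at each oracle, and
  \<open>church_bind\<close> with \<open>kleisli_apply\<close> gives its encoding.\<close>

lemma rel_kleisli:
  assumes g: "supported U \<Delta> (kleisliT A \<iota> \<iota>) \<rho>" and env: "env U \<Delta> \<delta>"
    and G: "G \<in> elems U (\<iota> \<rightarrow>\<^sub>T ChD A \<iota>)" and F: "\<And>n. rel U A \<iota> (F n) (ap U G (num U n))"
    and q: "rel U A \<iota> q d"
  shows "rel U A \<iota> (\<lambda>\<alpha>. F (to_nat U (q \<alpha>)) \<alpha>) (ap U (ap U (sem U (kleisliT A \<iota> \<iota>) \<delta>) G) d)"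
proof -
  let ?v = "ap U (ap U (sem U (kleisliT A \<iota> \<iota>) \<delta>) G) d"
  note g' = supported_retype[OF g kleisliT_typed]
  have s: "supports U ((\<iota> \<rightarrow>\<^sub>T ChD A \<iota>) \<rightarrow>\<^sub>T ChD A \<iota> \<rightarrow>\<^sub>T ChD A \<iota>)"
    by (rule supported_supports[OF g'])
  have si: "supports U \<iota>"
    using supports_FunD(1)[OF s] by (rule supports_FunD(1))
  have d: "d \<in> elems U (ChD A \<iota>)"
    using rel_in(2)[OF q] by simp
  obtain D where D: "\<And>\<alpha>. q \<alpha> = num U (dialogue D \<alpha>)"
    "\<And>e b. e \<in> elems U (\<iota> \<rightarrow>\<^sub>T A) \<Longrightarrow> b \<in> elems U (BrT A) \<Longrightarrow> ap U (ap U d e) b = church U e b D"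
    using q by auto
  \<comment> \<open>Sets up the choice of one tree \<open>k n\<close> for each number
    \<open>n\<close>.\<close>
  have "\<forall>n. \<exists>E. (\<forall>\<alpha>. F n \<alpha> = num U (dialogue E \<alpha>)) \<and>
      (\<forall>e \<in> elems U (\<iota> \<rightarrow>\<^sub>T A). \<forall>b \<in> elems U (BrT A).
        ap U (ap U (ap U G (num U n)) e) b = church U e b E)"
    using F by simp
  then obtain k where k: "\<And>n \<alpha>. F n \<alpha> = num U (dialogue (k n) \<alpha>)"
    "\<And>n e b. e \<in> elems U (\<iota> \<rightarrow>\<^sub>T A) \<Longrightarrow> b \<in> elems U (BrT A) \<Longrightarrow>
      ap U (ap U (ap U G (num U n)) e) b = church U e b (k n)"
    by metis
  have "?v \<in> elems U (ChD A \<iota>)"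
    using s sem_in[OF g' env] G d by (meson ap_in supports_FunD)
  moreover have "F (to_nat U (q \<alpha>)) \<alpha> = num U (dialogue (bind D k) \<alpha>)" for \<alpha>
    using si by (simp add: D(1) k(1) dialogue_bind)
  moreover have "ap U (ap U ?v e) b = church U e b (bind D k)"
    if eb: "e \<in> elems U (\<iota> \<rightarrow>\<^sub>T A)" "b \<in> elems U (BrT A)" for e b
  proof -
    obtain c where c: "c \<in> elems U (\<iota> \<rightarrow>\<^sub>T A)"
      "\<And>x. x \<in> elems U \<iota> \<Longrightarrow> ap U c x = ap U (ap U (ap U G x) e) b"
      "ap U (ap U ?v e) b = ap U (ap U d c) b"
      by (rule kleisli_apply[OF g env G d eb]) blast
    then have "church U e b (bind D k) = church U c b D"
      by (intro church_bind) (simp add: k(2)[OF eb])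
    then show ?thesis
      using c(1,3) D(2) eb(2) by simp
  qed
  ultimately show ?thesis by auto
qed

text \<open>Lifts \<open>rel_kleisli\<close> to all types. At an arrow, \<open>ext_apply\<close>
  moves the argument inside and the induction hypothesis is used for the family \<open>F\<close>
  applied to \<open>x\<close>; hence \<open>F\<close>, \<open>G\<close> and the environment are
  arbitrary.\<close>

lemma rel_ext:
  assumes "supported U \<Delta> (extT A \<sigma>) \<rho>" and "env U \<Delta> \<delta>"
    and "G \<in> elems U (\<iota> \<rightarrow>\<^sub>T trans_ty A \<sigma>)" and "\<And>n. rel U A \<sigma> (F n) (ap U G (num U n))"
    and "rel U A \<iota> q d" and "supports U \<sigma>"
  shows "rel U A \<sigma> (\<lambda>\<alpha>. F (to_nat U (q \<alpha>)) \<alpha>) (ap U (ap U (sem U (extT A \<sigma>) \<delta>) G) d)"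
  using assms
proof (induction \<sigma> arbitrary: \<Delta> \<delta> \<rho> G F)
  case Iota
  then show ?case using rel_kleisli[of U \<Delta> A \<rho> \<delta> G F q d] by simp
next
  case (Fun \<sigma> \<tau>)
  let ?v = "ap U (ap U (sem U (extT A (\<sigma> \<rightarrow>\<^sub>T \<tau>)) \<delta>) G) d"
  note g = supported_retype[OF Fun.prems(1) extT_typed] and F = Fun.prems(4)
  note d = rel_in(2)[OF Fun.prems(5)]
  have "rel U A \<tau> (\<lambda>\<alpha>. ap U (F (to_nat U (q \<alpha>)) \<alpha>) (x \<alpha>)) (ap U ?v y)"
    if xy: "rel U A \<sigma> x y" for x y
  proof -
    obtain \<Delta>' \<delta>' \<rho>' G' where g': "supported U \<Delta>' (extT A \<tau>) \<rho>'" "env U \<Delta>' \<delta>'"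
      "G' \<in> elems U (\<iota> \<rightarrow>\<^sub>T trans_ty A \<tau>)"
      and G': "\<And>n. ap U G' (num U n) = ap U (ap U G (num U n)) y"
      and v: "ap U ?v y = ap U (ap U (sem U (extT A \<tau>) \<delta>') G') d"
      by (rule ext_apply[OF Fun.prems(1,2,3) d rel_in(2)[OF xy]]) (rule that)
    have "rel U A \<tau> (\<lambda>\<alpha>. ap U (F n \<alpha>) (x \<alpha>)) (ap U G' (num U n))" for n
      unfolding G' by (rule rel_FunD[OF F xy])
    from Fun.IH(2)[where F = "\<lambda>n \<alpha>. ap U (F n \<alpha>) (x \<alpha>)", OF g' this Fun.prems(5)
        supports_FunD(2)[OF Fun.prems(6)]]
    show ?thesis unfolding v .
  qed
  moreover have "?v \<in> elems U (trans_ty A (\<sigma> \<rightarrow>\<^sub>T \<tau>))"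
    using supported_supports[OF g] sem_in[OF g Fun.prems(2)] Fun.prems(3) d
    by (meson ap_in supports_FunD)
  ultimately show ?case
    using rel_in(1)[OF F] unfolding rel.simps(2) by blast
qed

text \<open>\<open>mapT\<close> is the Kleisli extension of \<eta> after the successor, so
  \<open>rel_kleisli\<close> applies to the family of oracle-independent values
  \<open>n + 1\<close>.\<close>

lemma rel_succ:
  assumes g: "supported U \<Delta> (mapT A \<iota> \<iota> \<cdot> Lam \<iota> (Succ (Var 0))) \<rho>" and env: "env U \<Delta> \<delta>"
    and q: "rel U A \<iota> q d"
  shows "rel U A \<iota> (\<lambda>\<alpha>. num U (Suc (to_nat U (q \<alpha>))))
    (ap U (sem U (mapT A \<iota> \<iota> \<cdot> Lam \<iota> (Succ (Var 0))) \<delta>) d)"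
proof -
  let ?s = "sem U (Lam \<iota> (Succ (Var 0))) \<delta>"
  let ?\<Delta>1 = "(\<iota> \<rightarrow>\<^sub>T \<iota>) # \<Delta>"
  let ?g = "Lam \<iota> (etaT A \<iota> \<cdot> (Var 1 \<cdot> Var 0))"
  note gs = supported_AppD(2)[OF g mapT_typed]
    and gm = supported_AppD(1)[OF g mapT_typed, unfolded mapT_def]
  have s: "?s \<in> elems U (\<iota> \<rightarrow>\<^sub>T \<iota>)" by (rule sem_in[OF gs env])
  note env1 = env_Cons[OF env s]
  note gk = supported_AppD(1)[OF supported_LamD[OF gm] kleisliT_typed]
    and gg = supported_AppD(2)[OF supported_LamD[OF gm] kleisliT_typed]
  note ge = supported_AppD(1)[OF supported_LamD[OF gg] etaT_typed]
  have si: "supports U \<iota>" by (rule supports_FunD(1)[OF supported_supports[OF gs]])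
  have "rel U A \<iota> (\<lambda>_. num U (Suc n)) (ap U (sem U ?g (?s # \<delta>)) (num U n))" for n
  proof -
    have n: "num U n \<in> elems U \<iota>" by simp
    have "ap U ?s (num U n) = num U (Suc n)"
      unfolding ap_Lam[OF gs env n] using si by simp
    then have "ap U (sem U ?g (?s # \<delta>)) (num U n) =
        ap U (sem U (etaT A \<iota>) (num U n # ?s # \<delta>)) (num U (Suc n))"
      unfolding ap_Lam[OF gg env1 n] by simp
    then show ?thesis
      using rel_eta[OF ge env_Cons[OF env1 n], of "Suc n"] by simp
  qed
  from rel_kleisli[OF gk env1 sem_in[OF gg env1], where F = "\<lambda>n _. num U (Suc n)", OF this q]
  show ?thesis
    unfolding sem.simps(6) mapT_def ap_Lam[OF gm env s] .
qed

text \<open>At a fixed number the two recursions are compared by induction on the iterates;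
  \<open>rel_ext\<close> then replaces this number by an argument that depends on the
  oracle.\<close>

lemma rel_rec:
  defines "G A \<sigma> t p \<equiv> Lam \<iota> (Rec (trans_ty A \<sigma>)
    (Lam \<iota> (lift 0 (lift 0 t) \<cdot> (etaT A \<iota> \<cdot> Var 0))) (lift 0 p) (Var 0))"
  assumes g: "supported U \<Delta> (extT A \<sigma> \<cdot> G A \<sigma> t p) \<rho>" and env: "env U \<Delta> \<delta>"
    and t: "rel U A (\<iota> \<rightarrow>\<^sub>T \<sigma> \<rightarrow>\<^sub>T \<sigma>) ft (sem U t \<delta>)" and p: "rel U A \<sigma> fp (sem U p \<delta>)"
    and q: "rel U A \<iota> fq d" and \<sigma>: "supports U \<sigma>"
  shows "rel U A \<sigma>
    (\<lambda>\<alpha>. rec_nat (fp \<alpha>) (\<lambda>n. ap U (ap U (ft \<alpha>) (num U n))) (to_nat U (fq \<alpha>)))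
    (ap U (sem U (extT A \<sigma> \<cdot> G A \<sigma> t p) \<delta>) d)"
proof -
  let ?step = "Lam \<iota> (lift 0 (lift 0 t) \<cdot> (etaT A \<iota> \<cdot> Var 0))"
  note gext = supported_AppD(1)[OF g extT_typed] and gG = supported_AppD(2)[OF g extT_typed]
  note gG' = gG[unfolded G_def]
  have gstep: "supported U (\<iota> # \<Delta>) ?step (\<iota> \<rightarrow>\<^sub>T trans_ty A \<sigma> \<rightarrow>\<^sub>T trans_ty A \<sigma>)"
    using supported_LamD[OF gG'] unfolding supported_Rec by blast
  then obtain \<rho>' where ge: "supported U (\<iota> # \<iota> # \<Delta>) (etaT A \<iota>) \<rho>'" by auto
  have si: "supports U \<iota>" by (rule supports_FunD(1)[OF supported_supports[OF gG]])
  have n: "num U n \<in> elems U \<iota>" for n by simp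
  let ?F = "\<lambda>n \<alpha>. rec_nat (fp \<alpha>) (\<lambda>m. ap U (ap U (ft \<alpha>) (num U m))) n"
  have "rel U A \<sigma> (?F n) (ap U (sem U (G A \<sigma> t p) \<delta>) (num U n))" for n
  proof -
    note env1 = env_Cons[OF env n[of n]]
    \<comment> \<open>The environment holds the fixed recursion argument \<open>n\<close>, while the
      counter \<open>k\<close> runs through the iterates.\<close>
    let ?H = "\<lambda>k. rec_nat (sem U p \<delta>) (\<lambda>m. ap U (ap U (sem U ?step (num U n # \<delta>)) (num U m))) k"
    have "rel U A \<sigma> (?F k) (?H k)" for k
    proof (induction k)
      case 0
      show ?case using p by simp
    next
      case (Suc k)
      \<comment> \<open>The translated step receives its counter as \<eta> of a numeral, which
        \<open>rel_eta\<close> relates to that numeral.\<close>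
      note rel_FunD[OF rel_FunD[OF t rel_eta[OF ge env_Cons[OF env1 n]]] Suc]
      then show ?case
        by (simp add: ap_Lam[OF gstep env1 n])
    qed
    moreover have "ap U (sem U (G A \<sigma> t p) \<delta>) (num U n) = ?H n"
      unfolding G_def ap_Lam[OF gG' env n] using si by simp
    ultimately show ?thesis by simp
  qed
  from rel_ext[OF gext env sem_in[OF gG env], where F = ?F, OF this q \<sigma>]
  show ?thesis unfolding sem.simps(6) .
qed

section \<open>The fundamental lemma and the generic sequence\<close>

lemma rel_env:
  assumes "length \<gamma> = length \<Gamma>" "length \<delta> = length \<Gamma>"
    and "\<And>i. i < length \<Gamma> \<Longrightarrow> rel U A (\<Gamma> ! i) (\<gamma> ! i) (\<delta> ! i)"
  shows "env U \<Gamma> (map (\<lambda>f. f \<alpha>) \<gamma>)" "env U (map (trans_ty A) \<Gamma>) \<delta>"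
  using assms by (auto simp: env_def list_all2_conv_all_nth dest: rel_in)

text \<open>The fundamental lemma. Both the term and its translation are evaluated, so support is
  assumed for both and distributed to the subterms in each case.\<close>

lemma rel_sem:
  assumes "\<Gamma> \<turnstile> t : \<tau>"
    and "\<forall>\<sigma> \<in> term_types \<Gamma> t. supports U \<sigma>"
    and "\<forall>\<sigma> \<in> term_types (map (trans_ty A) \<Gamma>) (trans_tm A t). supports U \<sigma>"
    and "length \<gamma> = length \<Gamma>" "length \<delta> = length \<Gamma>"
    and "\<And>i. i < length \<Gamma> \<Longrightarrow> rel U A (\<Gamma> ! i) (\<gamma> ! i) (\<delta> ! i)"
  shows "rel U A \<tau> (\<lambda>\<alpha>. sem U t (map (\<lambda>f. f \<alpha>) \<gamma>)) (sem U (trans_tm A t) \<delta>)"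
  using assms
proof (induction arbitrary: \<gamma> \<delta> rule: has_type.induct)
  case (Var i \<Gamma>)
  then show ?case by simp
next
  case (Zero \<Gamma>)
  let ?\<Delta> = "map (trans_ty A) \<Gamma>"
  have "env U ?\<Delta> \<delta>"
    by (rule rel_env(2)[OF Zero.prems(3-5)])
  moreover have "supported U ?\<Delta> (etaT A \<iota>) (\<iota> \<rightarrow>\<^sub>T ChD A \<iota>)"
    using Zero.prems(2) unfolding trans_tm.simps term_types.simps by (simp add: supported_def etaT_typed)
  ultimately show ?case
    unfolding trans_tm.simps sem.simps by (rule rel_eta[rotated])
next
  case (Succ \<Gamma> t)
  note env = rel_env(2)[OF Succ.prems(3-5)]
  have IH: "rel U A \<iota> (\<lambda>\<alpha>. sem U t (map (\<lambda>f. f \<alpha>) \<gamma>)) (sem U (trans_tm A t) \<delta>)"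
  proof (rule Succ.IH[OF _ _ Succ.prems(3-5)])
    show "\<forall>\<sigma> \<in> term_types \<Gamma> t. supports U \<sigma>"
      using Succ.prems(1) unfolding term_types.simps by blast
    show "\<forall>\<sigma> \<in> term_types (map (trans_ty A) \<Gamma>) (trans_tm A t). supports U \<sigma>"
      using Succ.prems(2) unfolding trans_tm.simps term_types.simps by blast
  qed
  have "supported U (map (trans_ty A) \<Gamma>) (trans_tm A (Succ t)) (trans_ty A \<iota>)"
    using trans_tm_typed[OF has_type.Succ[OF Succ.hyps]] Succ.prems(2) unfolding supported_def by blast
  then obtain \<rho> where
    "supported U (map (trans_ty A) \<Gamma>) (mapT A \<iota> \<iota> \<cdot> Lam \<iota> (Succ (Var 0))) \<rho>"
    unfolding trans_tm.simps supported_App[where u = "trans_tm A t"] by blast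
  from rel_succ[OF this env IH] show ?case
    by (simp only: trans_tm.simps sem.simps Suc_eq_plus1)
next
  case (Rec \<Gamma> t \<sigma> p q)
  let ?\<Delta> = "map (trans_ty A) \<Gamma>"
  let ?t = "trans_tm A t" and ?p = "trans_tm A p"
  note env = rel_env(2)[OF Rec.prems(3-5)]
  have "supported U ?\<Delta> (trans_tm A (Rec \<sigma> t p q)) (trans_ty A \<sigma>)"
    using trans_tm_typed[OF has_type.Rec[OF Rec.hyps]] Rec.prems(2) unfolding supported_def by blast
  then obtain \<rho> where g: "supported U ?\<Delta> (extT A \<sigma> \<cdot> Lam \<iota> (Rec (trans_ty A \<sigma>)
      (Lam \<iota> (lift 0 (lift 0 ?t) \<cdot> (etaT A \<iota> \<cdot> Var 0))) (lift 0 ?p) (Var 0))) \<rho>"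
    unfolding trans_tm.simps supported_App[where u = "trans_tm A q"] by blast
  have sup: "\<forall>\<sigma> \<in> term_types \<Gamma> t. supports U \<sigma>" "\<forall>\<sigma> \<in> term_types \<Gamma> p. supports U \<sigma>"
    "\<forall>\<sigma> \<in> term_types \<Gamma> q. supports U \<sigma>"
    using Rec.prems(1) unfolding term_types.simps by blast+
  have "term_types ?\<Delta> ?t \<subseteq> term_types (\<iota> # \<iota> # ?\<Delta>) (lift 0 (lift 0 ?t))"
    using term_types_lift0 by (rule order_trans) (rule term_types_lift0)
  then have sup': "\<forall>\<sigma> \<in> term_types ?\<Delta> ?t. supports U \<sigma>" "\<forall>\<sigma> \<in> term_types ?\<Delta> ?p. supports U \<sigma>"
    "\<forall>\<sigma> \<in> term_types ?\<Delta> (trans_tm A q). supports U \<sigma>"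
    using Rec.prems(2) term_types_lift0[of ?\<Delta> ?p \<iota>] unfolding trans_tm.simps term_types.simps
    by blast+
  note t = Rec.IH(1)[OF sup(1) sup'(1) Rec.prems(3-5)]
    and p = Rec.IH(2)[OF sup(2) sup'(2) Rec.prems(3-5)]
    and q = Rec.IH(3)[OF sup(3) sup'(3) Rec.prems(3-5)]
  have "supported U \<Gamma> p \<sigma>"
    using Rec.hyps(2) Rec.prems(1) by (simp add: supported_def)
  from rel_rec[OF g env t p q supported_supports[OF this]] show ?case
    by (simp only: trans_tm.simps sem.simps)
next
  case (Lam \<sigma> \<Gamma> t \<tau>)
  note env = rel_env[OF Lam.prems(3-5)]
  have g: "supported U \<Gamma> (Lam \<sigma> t) (\<sigma> \<rightarrow>\<^sub>T \<tau>)"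
    using has_type.Lam[OF Lam.hyps] Lam.prems(1) by (simp only: supported_def)
  have g': "supported U (map (trans_ty A) \<Gamma>) (Lam (trans_ty A \<sigma>) (trans_tm A t)) (trans_ty A (\<sigma> \<rightarrow>\<^sub>T \<tau>))"
    using trans_tm_typed[OF has_type.Lam[OF Lam.hyps], of A] Lam.prems(2)
    by (simp only: supported_def trans_tm.simps)
  have "rel U A \<tau> (\<lambda>\<alpha>. ap U (sem U (Lam \<sigma> t) (map (\<lambda>f. f \<alpha>) \<gamma>)) (x \<alpha>))
      (ap U (sem U (trans_tm A (Lam \<sigma> t)) \<delta>) y)" if xy: "rel U A \<sigma> x y" for x y
  proof -
    \<comment> \<open>The two environments are extended by a related pair, and \<open>ap_Lam\<close>
      on each side turns the bodies back into applications.\<close>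
    have "rel U A \<tau> (\<lambda>\<alpha>. sem U t (map (\<lambda>f. f \<alpha>) (x # \<gamma>))) (sem U (trans_tm A t) (y # \<delta>))"
      by (rule Lam.IH) (use Lam.prems xy in \<open>auto simp: nth_Cons split: nat.splits\<close>)
    then show ?thesis
      by (simp add: ap_Lam[OF g env(1) rel_in(1)[OF xy]] ap_Lam[OF g' env(2) rel_in(2)[OF xy]])
  qed
  then show ?case
    using sem_in[OF g env(1)] sem_in[OF g' env(2)] unfolding rel.simps(2) trans_tm.simps by blast
next
  case (App \<Gamma> t \<sigma> \<tau> u)
  let ?\<Delta> = "map (trans_ty A) \<Gamma>"
  have sup: "\<forall>\<sigma> \<in> term_types \<Gamma> t. supports U \<sigma>" "\<forall>\<sigma> \<in> term_types \<Gamma> u. supports U \<sigma>"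
    using App.prems(1) unfolding term_types.simps by blast+
  have sup': "\<forall>\<sigma> \<in> term_types ?\<Delta> (trans_tm A t). supports U \<sigma>"
    "\<forall>\<sigma> \<in> term_types ?\<Delta> (trans_tm A u). supports U \<sigma>"
    using App.prems(2) unfolding trans_tm.simps term_types.simps by blast+
  from rel_FunD[OF App.IH(1)[OF sup(1) sup'(1) App.prems(3-5)]
      App.IH(2)[OF sup(2) sup'(2) App.prems(3-5)]]
  show ?case by (simp only: sem.simps trans_tm.simps)
qed

lemma rel_beta_eta:
  assumes g: "supported U \<Delta> (betaT A \<iota> \<cdot> etaT A \<iota> \<cdot> Var 0) (ChD A \<iota>)"
    and env: "env U \<Delta> (num U n # \<delta>)" and \<iota>: "supports U \<iota>"
  shows "rel U A \<iota> (\<lambda>\<alpha>. num U (\<alpha> n)) (sem U (betaT A \<iota> \<cdot> etaT A \<iota> \<cdot> Var 0) (num U n # \<delta>))"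
proof -
  \<comment> \<open>Brings the continuation into the shape of the branch clause of
    \<open>church\<close>, for the tree \<open>Node Leaf n\<close> that queries \<open>n\<close> and
    returns the answer.\<close>
  have "(\<lambda>y \<in> elems U \<iota>. ap U e y) = (\<lambda>y \<in> elems U \<iota>. church U e b (Leaf (to_nat U y)))" for e b
    using \<iota> by (intro restrict_ext) auto
  then have "ap U (ap U (sem U (betaT A \<iota> \<cdot> etaT A \<iota> \<cdot> Var 0) (num U n # \<delta>)) e) b
      = church U e b (Node Leaf n)"
    if "e \<in> elems U (\<iota> \<rightarrow>\<^sub>T A)" "b \<in> elems U (BrT A)" for e b
    unfolding beta_eta_apply[OF g env that] church.simps(2) by metis
  then show ?thesis
    using sem_in[OF g env] unfolding rel.simps trans_ty.simps
    by (intro conjI exI[of _ "Node Leaf n"]) simp_all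
qed

text \<open>Relates the oracle itself to the generic sequence: the tree of the argument computes a
  position, and a single query at this position is grafted on by \<open>rel_kleisli\<close>.\<close>

lemma rel_generic:
  assumes g: "supported U [] (genericT A) (trans_ty A \<iota> \<rightarrow>\<^sub>T trans_ty A \<iota>)"
    and s: "supports U (\<iota> \<rightarrow>\<^sub>T \<iota>)"
  shows "rel U A (\<iota> \<rightarrow>\<^sub>T \<iota>) (seq_code U) (sem U (genericT A) [])"
proof -
  let ?b = "betaT A \<iota> \<cdot> etaT A \<iota> \<cdot> Var 0"
  note g' = g[unfolded genericT_def]
  obtain \<rho> where gk: "supported U [] (kleisliT A \<iota> \<iota>) \<rho>" using g' by auto
  have gl: "supported U [] (Lam \<iota> ?b) (\<iota> \<rightarrow>\<^sub>T ChD A \<iota>)"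
    by (rule supported_AppD(2)[OF g' kleisliT_typed])
  then have gb: "supported U [\<iota>] ?b (ChD A \<iota>)" by auto
  have r: "rel U A \<iota> (\<lambda>\<alpha>. num U (\<alpha> n)) (ap U (sem U (Lam \<iota> ?b) []) (num U n))" for n
    using rel_beta_eta[OF gb, of n "[]"] supports_FunD(1)[OF s] ap_Lam[OF gl, of "[]" "num U n"] by simp
  have "rel U A \<iota> (\<lambda>\<alpha>. ap U (seq_code U \<alpha>) (x \<alpha>)) (ap U (sem U (genericT A) []) y)"
    if xy: "rel U A \<iota> x y" for x y
  proof -
    have "ap U (seq_code U \<alpha>) (x \<alpha>) = num U (\<alpha> (to_nat U (x \<alpha>)))" for \<alpha>
      using rel_in(1)[OF xy, of \<alpha>] ap_seq_code[OF s] supports_FunD[OF s] by auto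
    then show ?thesis
      using rel_kleisli[OF gk _ sem_in[OF gl], where F = "\<lambda>n \<alpha>. num U (\<alpha> n)", OF _ _ r xy]
      by (simp add: genericT_def)
  qed
  then show ?thesis
    unfolding rel.simps(2) using seq_code_in sem_in[OF g] by (auto simp del: rel.simps(1))
qed


section \<open>The modulus\<close>

text \<open>A path without queries yields 0, just as the leaf argument in \<open>maxQT\<close>
  does.\<close>

primrec max_query :: "dtree \<Rightarrow> (nat \<Rightarrow> nat) \<Rightarrow> nat" where
  "max_query (Leaf n) \<alpha> = 0"
| "max_query (Node \<phi> x) \<alpha> = max x (max_query (\<phi> (\<alpha> x)) \<alpha>)"

text \<open>At a branch the query is bounded by the maximum, so both oracles answer alike and enter
  the same subtree, whose maximum is no larger.\<close>

lemma dialogue_continuous: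
  "(\<And>i. i \<le> max_query D \<alpha> \<Longrightarrow> \<alpha> i = \<beta> i) \<Longrightarrow> dialogue D \<alpha> = dialogue D \<beta>"
  by (induction D) simp_all

text \<open>One tree must serve both claims: it computes \<open>f\<close> and its queries determine
  the modulus. The second claim folds this tree with the arguments from
  \<open>modulus_apply\<close>.\<close>

lemma functional_modulus:
  assumes g: "supported U [] (modulusT maxT \<cdot> t) \<tau>" and max: "is_max_term U maxT"
    and r: "rel U \<iota> \<iota> f (sem U t [])" and s: "supports U (\<iota> \<rightarrow>\<^sub>T \<iota>)"
  obtains D where "\<And>\<alpha>. f \<alpha> = num U (dialogue D \<alpha>)"
    "\<And>\<alpha>. functional U (modulusT maxT \<cdot> t) \<alpha> = Suc (max_query D \<alpha>)"
proof -
  note \<iota> = supports_FunD(1)[OF s] and d = rel_in(2)[OF r, unfolded trans_ty.simps]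
  obtain D where D: "\<And>\<alpha>. f \<alpha> = num U (dialogue D \<alpha>)"
    "\<And>e b. e \<in> elems U (\<iota> \<rightarrow>\<^sub>T \<iota>) \<Longrightarrow> b \<in> elems U (BrT \<iota>) \<Longrightarrow>
      ap U (ap U (sem U t []) e) b = church U e b D"
    using r by auto
  have "functional U (modulusT maxT \<cdot> t) \<alpha> = Suc (max_query D \<alpha>)" for \<alpha>
  proof -
    obtain e b where eb: "e \<in> elems U (\<iota> \<rightarrow>\<^sub>T \<iota>)" "b \<in> elems U (BrT \<iota>)"
      and e: "\<And>n. ap U e (num U n) = num U 0"
      and b: "\<And>g x y. g \<in> elems U (\<iota> \<rightarrow>\<^sub>T \<iota>) \<Longrightarrow> ap U g (num U (\<alpha> x)) = num U y \<Longrightarrow>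
        ap U (ap U b g) (num U x) = num U (max x y)"
      and m: "functional U (modulusT maxT \<cdot> t) \<alpha> = Suc (to_nat U (ap U (ap U (sem U t []) e) b))"
      by (rule modulus_apply[OF g max d]) (rule that)
    have "church U e b E = num U (max_query E \<alpha>)" for E
    proof (induction E)
      case (Leaf n)
      show ?case by (simp add: e)
    next
      case (Node \<phi> x)
      let ?c = "\<lambda>y. church U e b (\<phi> (to_nat U y))"
      \<comment> \<open>The induction hypothesis makes all subtree values numerals, so the family is
        a genuine function on \<iota> and its code can be evaluated.\<close>
      have c: "?c y \<in> elems U \<iota>" for y using Node by simp
      have "ap U (fun_code U (elems U \<iota>) (\<lambda>y \<in> elems U \<iota>. ?c y)) (num U (\<alpha> x))
          = num U (max_query (\<phi> (\<alpha> x)) \<alpha>)"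
        using ap_fun_code[OF s c, of "num U (\<alpha> x)"] Node \<iota> by simp
      from b[OF fun_code_in[OF c] this] show ?case
        unfolding church.simps max_query.simps .
    qed
    then show ?thesis
      unfolding m D(2)[OF eb] using \<iota> by simp
  qed
  with D(1) show ?thesis by (rule that)
qed

theorem theorem45:
  fixes U :: "'u universe" and t maxT :: tm
  assumes "[] \<turnstile> t : (\<iota> \<rightarrow>\<^sub>T \<iota>) \<rightarrow>\<^sub>T \<iota>"
    and "supports_term U t"
    and "supports_term U (modulusT maxT \<cdot> dialogue_tree \<iota> t)"
    and "is_max_term U maxT"
  shows "\<forall>\<alpha>. modulus_of_continuity_at (functional U t) \<alpha>
    (functional U (modulusT maxT \<cdot> dialogue_tree \<iota> t) \<alpha>)"
proof -
  let ?d = "dialogue_tree \<iota> t"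
  have "supported U [] t ((\<iota> \<rightarrow>\<^sub>T \<iota>) \<rightarrow>\<^sub>T \<iota>)"
    using assms(1,2) by (simp add: supported_def)
  then have s: "supports U (\<iota> \<rightarrow>\<^sub>T \<iota>)" "supports U \<iota>"
    using supported_supports supports_FunD by blast+
  have maxT: "\<Gamma> \<turnstile> maxT : \<iota> \<rightarrow>\<^sub>T \<iota> \<rightarrow>\<^sub>T \<iota>" for \<Gamma>
    using assms(4) weaken_closed by (simp add: is_max_term_def)
  have "[] \<turnstile> modulusT maxT \<cdot> ?d : (\<iota> \<rightarrow>\<^sub>T \<iota>) \<rightarrow>\<^sub>T \<iota>"
    by (rule has_type.App[OF modulusT_typed[OF maxT] dialogue_tree_typed[OF assms(1)]])
  then have g: "supported U [] (modulusT maxT \<cdot> ?d) ((\<iota> \<rightarrow>\<^sub>T \<iota>) \<rightarrow>\<^sub>T \<iota>)"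
    using assms(3) by (simp add: supported_def)
  obtain \<rho> where "supported U [] (genericT \<iota>) \<rho>"
    using g by (auto simp: dialogue_tree_def)
  then have gg: "supported U [] (genericT \<iota>) (trans_ty \<iota> \<iota> \<rightarrow>\<^sub>T trans_ty \<iota> \<iota>)"
    by (rule supported_retype) (simp add: genericT_typed)
  have "rel U \<iota> ((\<iota> \<rightarrow>\<^sub>T \<iota>) \<rightarrow>\<^sub>T \<iota>) (\<lambda>\<alpha>. sem U t (map (\<lambda>f. f \<alpha>) [])) (sem U (trans_tm \<iota> t) [])"
    by (rule rel_sem[OF assms(1,2)]) (use assms(3) in \<open>auto simp: dialogue_tree_def\<close>)
  \<comment> \<open>Applying the related functional to the related oracle produces
    \<open>dialogue_tree\<close>, which is by definition the translated term applied to the generic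
    sequence.\<close>
  from rel_FunD[OF this rel_generic[OF gg s(1)]]
  have "rel U \<iota> \<iota> (\<lambda>\<alpha>. ap U (sem U t []) (seq_code U \<alpha>)) (sem U ?d [])"
    by (simp add: dialogue_tree_def)
  then obtain D where D: "\<And>\<alpha>. ap U (sem U t []) (seq_code U \<alpha>) = num U (dialogue D \<alpha>)"
    "\<And>\<alpha>. functional U (modulusT maxT \<cdot> ?d) \<alpha> = Suc (max_query D \<alpha>)"
    by (rule functional_modulus[OF g assms(4) _ s(1)]) blast
  then have "functional U t \<alpha> = dialogue D \<alpha>" for \<alpha>
    using s(2) by (simp add: functional_def)
  then show ?thesis
    \<comment> \<open>The successor in \<open>modulusT\<close> puts the largest query itself below
      the modulus, as \<open>dialogue_continuous\<close> requires.\<close>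
    unfolding modulus_of_continuity_at_def D(2) less_Suc_eq_le
    using dialogue_continuous by metis
qed

end
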